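(* Let $(\Omega,\Sigma,\mu)$ be a probability space, let $H$ be a complex Hilbert space, and let $f\in L^2(\Omega,H)$ be a zero-mean random function with auto-covariance operator $E_{ff}\in\mathcal{B}(H)$. If the range $E_{ff}(H)\subseteq H$ is not closed, then the generalized inverse auto-covariance operator $E_{ff}^{\dagger}:D(E_{ff}^{\dagger})\subseteq H\to H$ is an unbounded, closed, densely defined, self-adjoint linear operator.
   Context: $\Sigma$ is a complete $\sigma$-field. A function $f:\Omega\to H$ is strongly $\Sigma$-measurable if it is the $\mu$-almost everywhere norm limit of a sequence of finitely valued functions (finite sums $\sum_j\chi_{E_j}c_j$ with $E_j\in\Sigma$ disjoint, $c_j\in H$). $L^2(\Omega,H)$ is the space of strongly $\Sigma$-measurable $f:\Omega\to H$ with $\mathbb{E}[\|f\|^2]=\int_\Omega\|f(\omega)\|^2\mu(d\omega)<\infty$; integrals of $H$-valued functions are Bochner integrals, and $f$ has zero mean if $\int_\Omega f\,d\mu=0$. Inner products are linear in the first argument. $H$ need not be separable. The auto-covariance operator is $E_{ff}x=\mathbb{E}[\langle x,f\rangle f]=\int_\Omega\langle x,f(\omega)\rangle f(\omega)\,\mu(d\omega)$, $x\in H$. It is positive semi-definite and self-adjoint, and there is a countable orthonormal basis $\{x_j\}$ of $(\ker E_{ff})^\perp$ with $E_{ff}x_j=\lambda_jx_j$, $\lambda_j>0$. The generalized inverse has domain $D(E_{ff}^{\dagger})=E_{ff}(H)\oplus\ker E_{ff}$ and is given by $E_{ff}^{\dagger}u=\sum_j\lambda_j^{-1}\langle u,x_j\rangle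 x_j$ for $u\in D(E_{ff}^{\dagger})$. *)

theory Defs
  imports "HOL-Probability.Probability"
begin

section \<open>Complex Hilbert spaces\<close>

text \<open>The inner product is linear in its first argument. The real structure that comes with
  \<^class>\<open>real_normed_vector\<close> is the restriction of the complex one.\<close>

class complex_inner = real_normed_vector +
  fixes scaleC :: "complex \<Rightarrow> 'a \<Rightarrow> 'a"  (infixr \<open>*\<^sub>C\<close> 75)
    and cinner :: "'a \<Rightarrow> 'a \<Rightarrow> complex"
  assumes scaleC_add_right: "a *\<^sub>C (x + y) = a *\<^sub>C x + a *\<^sub>C y"
    and scaleC_add_left: "(a + b) *\<^sub>C x = a *\<^sub>C x + b *\<^sub>C x"
    and scaleC_scaleC: "a *\<^sub>C b *\<^sub>C x = (a * b) *\<^sub>C x"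
    and scaleR_scaleC: "r *\<^sub>R x = complex_of_real r *\<^sub>C x"
    and cinner_commute: "cinner x y = cnj (cinner y x)"
    and cinner_add_left: "cinner (x + y) z = cinner x z + cinner y z"
    and cinner_scaleC_left: "cinner (a *\<^sub>C x) y = a * cinner x y"
    and cinner_ge_zero: "0 \<le> Re (cinner x x)"
    and cinner_eq_zero_iff: "cinner x x = 0 \<longleftrightarrow> x = 0"
    and norm_eq_sqrt_cinner: "norm x = sqrt (Re (cinner x x))"

class chilbert_space = complex_inner + complete_space

instantiation complex :: chilbert_space
begin

definition scaleC_complex :: "complex \<Rightarrow> complex \<Rightarrow> complex" where
  "scaleC_complex a x = a * x"

definition cinner_complex :: "complex \<Rightarrow> complex \<Rightarrow> complex" where
  "cinner_complex x y = x * cnj y"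

instance
  by standard
    (simp_all add: scaleC_complex_def cinner_complex_def algebra_simps scaleR_conv_of_real
      cmod_def power2_eq_square)

end

definition csubspace :: "'h::complex_inner set \<Rightarrow> bool" where
  "csubspace S \<longleftrightarrow> 0 \<in> S \<and> (\<forall>x\<in>S. \<forall>y\<in>S. x + y \<in> S) \<and> (\<forall>a. \<forall>x\<in>S. a *\<^sub>C x \<in> S)"

definition cspan :: "'h::complex_inner set \<Rightarrow> 'h set" where
  "cspan S = csubspace hull S"

definition ortho_complement :: "'h::complex_inner set \<Rightarrow> 'h set" where
  "ortho_complement S = {y. \<forall>x\<in>S. cinner y x = 0}"

definition orthonormal :: "'h::complex_inner set \<Rightarrow> bool" where
  "orthonormal X \<longleftrightarrow> (\<forall>x\<in>X. \<forall>y\<in>X. cinner x y = (if x = y then 1 else 0))"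

definition is_onb_of :: "'h::complex_inner set \<Rightarrow> 'h set \<Rightarrow> bool" where
  "is_onb_of X V \<longleftrightarrow> orthonormal X \<and> closure (cspan X) = V"


section \<open>Strong measurability and the Bochner integral\<close>

text \<open>The Bochner integral of HOL-Analysis is restricted to second countable target spaces. The
  definition is repeated here with strong measurability in place of Borel measurability, so that
  the target may be non-separable.\<close>

definition strongly_measurable :: "'w measure \<Rightarrow> ('w \<Rightarrow> 'b::real_normed_vector) \<Rightarrow> bool" where
  "strongly_measurable M f \<longleftrightarrow>
    (\<exists>s. (\<forall>i. simple_function M (s i)) \<and> (AE w in M. (\<lambda>i. s i w) \<longlonglongrightarrow> f w))"

definition has_strong_integral ::
    "'w measure \<Rightarrow> ('w \<Rightarrow> 'b::real_normed_vector) \<Rightarrow> 'b \<Rightarrow> bool" where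
  "has_strong_integral M f I \<longleftrightarrow>
    strongly_measurable M f \<and>
    (\<exists>s. (\<forall>i. Bochner_Integration.simple_bochner_integrable M (s i)) \<and>
         (\<lambda>i. \<integral>\<^sup>+w. norm (f w - s i w) \<partial>M) \<longlonglongrightarrow> 0 \<and>
         (\<lambda>i. Bochner_Integration.simple_bochner_integral M (s i)) \<longlonglongrightarrow> I)"

definition strong_integral :: "'w measure \<Rightarrow> ('w \<Rightarrow> 'b::real_normed_vector) \<Rightarrow> 'b" where
  "strong_integral M f =
    (if \<exists>I. has_strong_integral M f I then THE I. has_strong_integral M f I else 0)"

definition L2_functions :: "'w measure \<Rightarrow> ('w \<Rightarrow> 'b::real_normed_vector) set" where
  "L2_functions M = {f. strongly_measurable M f \<and> integrable M (\<lambda>w. (norm (f w))\<^sup>2)}"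

definition zero_mean :: "'w measure \<Rightarrow> ('w \<Rightarrow> 'b::real_normed_vector) \<Rightarrow> bool" where
  "zero_mean M f \<longleftrightarrow> has_strong_integral M f 0"

definition autocov :: "'w measure \<Rightarrow> ('w \<Rightarrow> 'h::chilbert_space) \<Rightarrow> 'h \<Rightarrow> 'h" where
  "autocov M f x = strong_integral M (\<lambda>w. cinner x (f w) *\<^sub>C f w)"


section \<open>Partially defined operators\<close>

text \<open>An operator with domain \<open>D\<close> is given by \<open>D\<close> and a function \<open>T\<close> of which only the values on
  \<open>D\<close> matter.\<close>

definition linear_operator :: "'h::complex_inner set \<Rightarrow> ('h \<Rightarrow> 'h) \<Rightarrow> bool" where
  "linear_operator D T \<longleftrightarrow>
    csubspace D \<and>
    (\<forall>x\<in>D. \<forall>y\<in>D. T (x + y) = T x + T y) \<and>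
    (\<forall>a. \<forall>x\<in>D. T (a *\<^sub>C x) = a *\<^sub>C T x)"

definition bounded_operator :: "'h::complex_inner set \<Rightarrow> ('h \<Rightarrow> 'h) \<Rightarrow> bool" where
  "bounded_operator D T \<longleftrightarrow> (\<exists>C. \<forall>x\<in>D. norm (T x) \<le> C * norm x)"

definition closed_operator :: "'h::complex_inner set \<Rightarrow> ('h \<Rightarrow> 'h) \<Rightarrow> bool" where
  "closed_operator D T \<longleftrightarrow> closed {(x, T x) |x. x \<in> D}"

definition densely_defined :: "'h::complex_inner set \<Rightarrow> bool" where
  "densely_defined D \<longleftrightarrow> closure D = UNIV"

definition adjoint_domain :: "'h::complex_inner set \<Rightarrow> ('h \<Rightarrow> 'h) \<Rightarrow> 'h set" where
  "adjoint_domain D T = {y. \<exists>z. \<forall>x\<in>D. cinner (T x) y = cinner x z}"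

text \<open>The value is unique only if \<open>D\<close> is dense.\<close>

definition adjoint_operator :: "'h::complex_inner set \<Rightarrow> ('h \<Rightarrow> 'h) \<Rightarrow> 'h \<Rightarrow> 'h" where
  "adjoint_operator D T y = (THE z. \<forall>x\<in>D. cinner (T x) y = cinner x z)"

definition self_adjoint_operator :: "'h::complex_inner set \<Rightarrow> ('h \<Rightarrow> 'h) \<Rightarrow> bool" where
  "self_adjoint_operator D T \<longleftrightarrow>
    densely_defined D \<and> adjoint_domain D T = D \<and> (\<forall>y\<in>D. adjoint_operator D T y = T y)"


section \<open>The generalized inverse\<close>

definition kernel :: "('h::complex_inner \<Rightarrow> 'h) \<Rightarrow> 'h set" where
  "kernel A = {x. A x = 0}"

text \<open>The basis is a set of vectors, finite or countably infinite, and \<open>l x\<close> is the eigenvalue of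
  the basis vector \<open>x\<close>.\<close>

definition eigenbasis :: "('h::complex_inner \<Rightarrow> 'h) \<Rightarrow> 'h set \<Rightarrow> ('h \<Rightarrow> real) \<Rightarrow> bool" where
  "eigenbasis A X l \<longleftrightarrow>
    countable X \<and> is_onb_of X (ortho_complement (kernel A)) \<and>
    (\<forall>x\<in>X. 0 < l x \<and> A x = l x *\<^sub>R x)"

definition ginv_domain :: "('h::complex_inner \<Rightarrow> 'h) \<Rightarrow> 'h set" where
  "ginv_domain A = {a + b |a b. a \<in> range A \<and> b \<in> kernel A}"

text \<open>The choice of eigenbasis does not affect the values on \<^const>\<open>ginv_domain\<close>.\<close>

definition ginv :: "('h::complex_inner \<Rightarrow> 'h) \<Rightarrow> 'h \<Rightarrow> 'h" where
  "ginv A u =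
    (let (X, l) = (SOME (X, l). eigenbasis A X l)
     in \<Sum>\<^sub>\<infinity>x\<in>X. inverse (l x) *\<^sub>R cinner u x *\<^sub>C x)"

end

theory Submission
  imports Defs
begin

text \<open>
  Write \<open>A\<close> for the auto-covariance operator and \<open>N\<close> for its kernel. Weakly,
  \<open>\<langle>A x, y\<rangle> = \<integral> \<langle>x, f\<rangle> \<langle>f, y\<rangle>\<close>, so \<open>A\<close> is linear, symmetric and positive, and Bessel's inequality
  bounds \<open>\<Sum> \<langle>A e, e\<rangle>\<close> over finite orthonormal families by \<open>\<integral> \<parallel>f\<parallel>\<^sup>2\<close>. The trace bound alone yields an
  eigenbasis. Expanding in it shows that the graph of the generalized inverse is
  \<open>{(u, g). g \<in> N\<^sup>\<bottom> \<and> u - A g \<in> N}\<close>, independently of the basis chosen. This set is closed, its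
  domain contains \<open>N\<close> and all eigenvectors, and self-adjointness follows from \<open>N\<^sup>\<bottom>\<^sup>\<bottom> = N\<close>. A bound on
  the inverse would make preimages in \<open>N\<^sup>\<bottom>\<close> of a convergent sequence of the range a Cauchy sequence,
  so the range would be closed.
\<close>

section \<open>Inner product and norm\<close>

lemma cinner_add_right: "cinner x (y + z) = cinner x y + cinner x (z :: 'h::complex_inner)"
  using cinner_add_left[of y z x] by (metis cinner_commute complex_cnj_add)

lemma cinner_scaleC_right: "cinner x (a *\<^sub>C y) = cnj a * cinner x (y :: 'h::complex_inner)"
  by (metis cinner_commute cinner_scaleC_left complex_cnj_mult)

lemma cinner_zero_left [simp]: "cinner 0 x = 0"
  using cinner_add_left[of 0 0 x] by simp

lemma cinner_zero_right [simp]: "cinner x 0 = 0"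
  using cinner_add_right[of x 0 0] by simp

lemma cinner_minus_left: "cinner (- x) y = - cinner x (y :: 'h::complex_inner)"
  using cinner_add_left[of x "-x" y] by (simp add: add_eq_0_iff2)

lemma cinner_minus_right: "cinner x (- y) = - cinner x (y :: 'h::complex_inner)"
  using cinner_add_right[of x y "-y"] by (simp add: add_eq_0_iff2)

lemma cinner_diff_left: "cinner (x - y) z = cinner x z - cinner y (z :: 'h::complex_inner)"
  using cinner_add_left[of x "-y" z] by (simp add: cinner_minus_left)

lemma cinner_diff_right: "cinner x (y - z) = cinner x y - cinner x (z :: 'h::complex_inner)"
  using cinner_add_right[of x y "-z"] by (simp add: cinner_minus_right)

lemma cinner_sum_left: "cinner (sum g S) y = (\<Sum>i\<in>S. cinner (g i) (y :: 'h::complex_inner))"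
  by (induction S rule: infinite_finite_induct) (auto simp: cinner_add_left)

lemma cinner_sum_right: "cinner y (sum g S) = (\<Sum>i\<in>S. cinner (y :: 'h::complex_inner) (g i))"
  by (induction S rule: infinite_finite_induct) (auto simp: cinner_add_right)

lemma cinner_scaleR_left: "cinner (r *\<^sub>R x) y = of_real r * cinner x (y :: 'h::complex_inner)"
  by (simp add: scaleR_scaleC cinner_scaleC_left)

lemma cinner_scaleR_right: "cinner x (r *\<^sub>R y) = of_real r * cinner x (y :: 'h::complex_inner)"
  by (simp add: scaleR_scaleC cinner_scaleC_right)

lemmas cinner_simps = cinner_add_left cinner_add_right cinner_diff_left cinner_diff_right
  cinner_scaleC_left cinner_scaleC_right cinner_scaleR_left cinner_scaleR_right
  cinner_minus_left cinner_minus_right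

lemma cinner_self: "cinner x x = of_real ((norm (x :: 'h::complex_inner))\<^sup>2)"
proof -
  have "Im (cinner x x) = 0"
    using cinner_commute[of x x] by (simp add: complex_eq_iff)
  moreover have "Re (cinner x x) = (norm x)\<^sup>2"
    by (simp add: norm_eq_sqrt_cinner cinner_ge_zero)
  ultimately show ?thesis by (simp add: complex_eq_iff)
qed

lemma norm_sq_eq_cinner: "(norm (x :: 'h::complex_inner))\<^sup>2 = Re (cinner x x)"
  by (simp add: cinner_self)

lemma scaleC_one [simp]: "1 *\<^sub>C x = (x :: 'h::complex_inner)"
  using scaleR_scaleC[of 1 x] by simp

lemma scaleC_zero_left [simp]: "0 *\<^sub>C x = (0 :: 'h::complex_inner)"
  using scaleC_add_left[of 0 0 x] by simp

lemma scaleC_zero_right [simp]: "a *\<^sub>C 0 = (0 :: 'h::complex_inner)"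
  using scaleC_add_right[of a 0 0] by simp

lemma scaleC_minus_left: "(- a) *\<^sub>C x = - (a *\<^sub>C (x :: 'h::complex_inner))"
  using scaleC_add_left[of a "-a" x] by (simp add: add_eq_0_iff2)

lemma scaleC_sum_right: "a *\<^sub>C sum g S = (\<Sum>i\<in>S. a *\<^sub>C (g i :: 'h::complex_inner))"
  by (induction S rule: infinite_finite_induct) (auto simp: scaleC_add_right)

lemma scaleC_minus_one: "(- 1) *\<^sub>C x = - (x :: 'h::complex_inner)"
  by (simp add: scaleC_minus_left)

lemma norm_scaleC: "norm (a *\<^sub>C x) = cmod a * norm (x :: 'h::complex_inner)"
proof -
  have "cinner (a *\<^sub>C x) (a *\<^sub>C x) = (a * cnj a) * cinner x x"
    by (simp add: cinner_scaleC_left cinner_scaleC_right)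
  also have "\<dots> = of_real ((cmod a * norm x)\<^sup>2)"
    by (simp only: cinner_self complex_norm_square[symmetric] power_mult_distrib of_real_mult)
  finally have "cinner (a *\<^sub>C x) (a *\<^sub>C x) = of_real ((cmod a * norm x)\<^sup>2)" .
  then have "(norm (a *\<^sub>C x))\<^sup>2 = (cmod a * norm x)\<^sup>2"
    by (simp only: norm_sq_eq_cinner) simp
  then show ?thesis by (simp add: power2_eq_iff_nonneg)
qed

lemma bounded_bilinear_scaleC:
  "bounded_bilinear ((*\<^sub>C) :: complex \<Rightarrow> 'h::complex_inner \<Rightarrow> 'h)"
proof
  fix r :: real and a :: complex and b :: 'h
  show "(r *\<^sub>R a) *\<^sub>C b = r *\<^sub>R a *\<^sub>C b"
    by (simp add: scaleR_scaleC scaleC_scaleC scaleC_complex_def)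
  show "a *\<^sub>C (r *\<^sub>R b) = r *\<^sub>R a *\<^sub>C b"
    by (simp add: scaleR_scaleC scaleC_scaleC mult.commute)
  show "\<exists>K. \<forall>(a::complex) (b::'h). norm (a *\<^sub>C b) \<le> norm a * norm b * K"
    by (rule exI[of _ 1]) (simp add: norm_scaleC)
qed (simp_all add: scaleC_add_left scaleC_add_right)

lemma norm_diff_sq:
  "(norm (x - y))\<^sup>2 = (norm x)\<^sup>2 + (norm y)\<^sup>2 - 2 * Re (cinner x (y :: 'h::complex_inner))"
  using arg_cong[OF cinner_commute[of y x], of Re]
  by (simp add: norm_sq_eq_cinner cinner_simps)

lemma norm_add_sq:
  "(norm (x + y))\<^sup>2 = (norm x)\<^sup>2 + (norm y)\<^sup>2 + 2 * Re (cinner x (y :: 'h::complex_inner))"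
  using norm_diff_sq[of x "-y"] by (simp add: cinner_simps)

lemma csubspaceD:
  assumes "csubspace (S :: 'h::complex_inner set)"
  shows "0 \<in> S" "x \<in> S \<Longrightarrow> y \<in> S \<Longrightarrow> x + y \<in> S" "x \<in> S \<Longrightarrow> a *\<^sub>C x \<in> S"
    "x \<in> S \<Longrightarrow> r *\<^sub>R x \<in> S" "x \<in> S \<Longrightarrow> - x \<in> S" "x \<in> S \<Longrightarrow> y \<in> S \<Longrightarrow> x - y \<in> S"
proof -
  show *: "0 \<in> S" "x \<in> S \<Longrightarrow> y \<in> S \<Longrightarrow> x + y \<in> S" "x \<in> S \<Longrightarrow> a *\<^sub>C x \<in> S" for x y a
    using assms by (auto simp: csubspace_def)
  show "x \<in> S \<Longrightarrow> r *\<^sub>R x \<in> S" by (simp add: scaleR_scaleC *)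
  show **: "x \<in> S \<Longrightarrow> - x \<in> S" for x by (metis scaleC_minus_one *(3))
  show "x \<in> S \<Longrightarrow> y \<in> S \<Longrightarrow> x - y \<in> S" using *(2)[of x "-y"] ** by simp
qed

text \<open>Nonnegativity is asked on a subspace \<open>W\<close> because, besides the inner product
  and the form of the operator, the lemma serves the form of \<open>m - A\<close>, whose
  nonnegativity is known only on an invariant subspace. The bound comes from a real quadratic
  polynomial that never becomes negative.\<close>

lemma cauchy_schwarz_of_semidefinite:
  fixes b :: "'h::complex_inner \<Rightarrow> 'h \<Rightarrow> complex"
  assumes add: "\<And>x y z. b (x + y) z = b x z + b y z"
    and scale: "\<And>a x z. b (a *\<^sub>C x) z = a * b x z"
    and herm: "\<And>x y. b x y = cnj (b y x)"
    and pos: "\<And>x. x \<in> W \<Longrightarrow> 0 \<le> Re (b x x)"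
    and W: "csubspace W" "x \<in> W" "y \<in> W"
  shows "(cmod (b x y))\<^sup>2 \<le> Re (b x x) * Re (b y y)"
proof -
  have add': "b x (y + z) = b x y + b x z" for x y z
    using add[of y z x] by (metis herm complex_cnj_add)
  have scale': "b x (a *\<^sub>C y) = cnj a * b x y" for a x y
    by (metis herm scale complex_cnj_mult)
  have "0 \<le> Re (b x x) + 2 * t * (cmod (b x y))\<^sup>2 + t\<^sup>2 * (cmod (b x y))\<^sup>2 * Re (b y y)" for t
  proof -
    \<comment> \<open>The factor \<open>b x y\<close> cancels the phase of the cross terms: they add
      up to the real number \<open>2 * t * (cmod (b x y))\<^sup>2\<close>, so a real parameter
      \<open>t\<close> suffices.\<close>
    let ?c = "of_real t * b x y"
    have "0 \<le> Re (b (x + ?c *\<^sub>C y) (x + ?c *\<^sub>C y))"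
      by (intro pos csubspaceD(2,3)[OF W(1)] W(2,3))
    also have "b (x + ?c *\<^sub>C y) (x + ?c *\<^sub>C y) =
        b x x + of_real t * (cnj (b x y) * b x y + b x y * b y x)
          + of_real (t\<^sup>2) * (b x y * cnj (b x y)) * b y y"
      by (simp add: add add' scale scale' algebra_simps power2_eq_square)
    also have "b y x = cnj (b x y)" by (rule herm)
    also have "b x x + of_real t * (cnj (b x y) * b x y + b x y * cnj (b x y))
          + of_real (t\<^sup>2) * (b x y * cnj (b x y)) * b y y =
        b x x + of_real (2 * t * (cmod (b x y))\<^sup>2)
          + of_real (t\<^sup>2 * (cmod (b x y))\<^sup>2) * b y y"
      by (simp add: complex_norm_square algebra_simps del: of_real_power)
    finally show ?thesis by simp
  qed note q = this
  define p r n where "p = Re (b x x)" and "r = Re (b y y)" and "n = (cmod (b x y))\<^sup>2"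
  have q': "0 \<le> p + 2 * t * n + t\<^sup>2 * n * r" for t
    using q[of t] by (simp add: p_def r_def n_def)
  have n0: "0 \<le> n" and r0: "0 \<le> r" and p0: "0 \<le> p"
    by (auto simp: n_def r_def p_def pos W)
  have "n \<le> p * r"
  proof (cases "r = 0")
    case True
    \<comment> \<open>For \<open>r = 0\<close> the polynomial is affine in \<open>t\<close>; a
      nonzero slope would let it drop to the negative value \<open>- p - 2\<close>.\<close>
    have "n = 0"
    proof (rule ccontr)
      assume "n \<noteq> 0"
      then have "0 < n" using n0 by simp
      have "p + 2 * (- (p + 1) / n) * n = - p - 2"
        using \<open>0 < n\<close> by (simp add: field_simps)
      then show False using q'[of "- (p + 1) / n"] True p0 by simp
    qed
    then show ?thesis using True by simp
  next
    case False
    then have "0 < r" using r0 by simp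
    \<comment> \<open>The polynomial is minimal at \<open>t = - 1 / r\<close>.\<close>
    have "p + 2 * (- 1 / r) * n + (- 1 / r)\<^sup>2 * n * r = p - n / r"
      using \<open>0 < r\<close> by (simp add: field_simps power2_eq_square)
    then have "n / r \<le> p" using q'[of "- 1 / r"] by simp
    then show ?thesis using \<open>0 < r\<close> by (simp add: field_simps)
  qed
  then show ?thesis by (simp add: p_def r_def n_def)
qed

lemma cauchy_schwarz: "cmod (cinner x y) \<le> norm x * norm (y :: 'h::complex_inner)"
proof -
  have "(cmod (cinner x y))\<^sup>2 \<le> Re (cinner x x) * Re (cinner y y)"
    by (rule cauchy_schwarz_of_semidefinite[where W = UNIV])
      (auto simp: cinner_simps cinner_ge_zero csubspace_def intro: cinner_commute)
  then have "(cmod (cinner x y))\<^sup>2 \<le> (norm x * norm y)\<^sup>2"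
    by (simp add: norm_sq_eq_cinner power_mult_distrib)
  then show ?thesis by (rule power2_le_imp_le) simp
qed

lemma bounded_bilinear_cinner:
  "bounded_bilinear (cinner :: 'h::complex_inner \<Rightarrow> 'h \<Rightarrow> complex)"
proof
  show "\<exists>K. \<forall>(a::'h) b. norm (cinner a b) \<le> norm a * norm b * K"
    by (rule exI[of _ 1]) (simp add: cauchy_schwarz)
qed (simp_all add: cinner_simps scaleR_conv_of_real)

lemmas tendsto_cinner [tendsto_intros] = bounded_bilinear.tendsto[OF bounded_bilinear_cinner]
lemmas tendsto_scaleC [tendsto_intros] = bounded_bilinear.tendsto[OF bounded_bilinear_scaleC]
lemmas continuous_on_cinner [continuous_intros] =
  bounded_bilinear.continuous_on[OF bounded_bilinear_cinner]
lemmas continuous_on_scaleC [continuous_intros] =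
  bounded_bilinear.continuous_on[OF bounded_bilinear_scaleC]

lemma cinner_ext: "(\<And>y. cinner x y = cinner z y) \<Longrightarrow> x = (z :: 'h::complex_inner)"
  using cinner_eq_zero_iff[of "x - z"] by (simp add: cinner_diff_left)


section \<open>Orthogonal projection\<close>

lemma csubspace_sum:
  "csubspace S \<Longrightarrow> (\<And>i. i \<in> I \<Longrightarrow> g i \<in> S) \<Longrightarrow> sum g I \<in> (S :: 'h::complex_inner set)"
  by (induction I rule: infinite_finite_induct) (auto simp: csubspaceD)

lemma csubspace_ortho_complement [simp]: "csubspace (ortho_complement S)"
  by (auto simp: csubspace_def ortho_complement_def cinner_simps)

lemma closed_ortho_complement [simp]: "closed (ortho_complement S)"
proof -
  have "ortho_complement S = (\<Inter>x\<in>S. {y. cinner y x = 0})"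
    by (auto simp: ortho_complement_def)
  moreover have "closed {y. cinner y x = 0}" for x :: 'a
    by (intro closed_Collect_eq continuous_intros)
  ultimately show ?thesis by auto
qed

lemma ortho_complement_swap:
  "y \<in> ortho_complement S \<Longrightarrow> x \<in> S \<Longrightarrow> cinner x y = 0"
  by (metis (mono_tags, lifting) cinner_commute complex_cnj_zero mem_Collect_eq
      ortho_complement_def)

text \<open>Subtracting from \<open>v\<close> its projection onto the line of \<open>y\<close>
  lowers the squared norm by \<open>(cmod (cinner v y))\<^sup>2 / (norm y)\<^sup>2\<close>;
  minimality forces this loss to vanish.\<close>

lemma orthogonal_if_minimal:
  fixes p :: "'h::complex_inner"
  assumes min: "\<And>a. norm v \<le> norm (v - a *\<^sub>C y)"
  shows "cinner v y = 0"
proof (cases "y = 0")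
  case False
  define a where "a = cinner v y / of_real ((norm y)\<^sup>2)"
  have ny: "norm y > 0" using False by simp
  have "(norm (v - a *\<^sub>C y))\<^sup>2 = (norm v)\<^sup>2 - (cmod (cinner v y))\<^sup>2 / (norm y)\<^sup>2"
  proof -
    have "cnj a * cinner v y = of_real ((cmod (cinner v y))\<^sup>2 / (norm y)\<^sup>2)"
      by (simp add: a_def complex_norm_square mult.commute del: of_real_power)
    moreover have "(cmod a * norm y)\<^sup>2 = (cmod (cinner v y))\<^sup>2 / (norm y)\<^sup>2"
      using ny by (simp add: a_def norm_divide norm_power power_mult_distrib power_divide
          field_simps power2_eq_square norm_mult)
    ultimately show ?thesis
      by (simp add: norm_diff_sq norm_scaleC cinner_simps del: of_real_power of_real_divide)
  qed
  moreover have "(norm v)\<^sup>2 \<le> (norm (v - a *\<^sub>C y))\<^sup>2"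
    using min[of a] by (simp add: power_mono)
  ultimately have "(cmod (cinner v y))\<^sup>2 / (norm y)\<^sup>2 \<le> 0" by simp
  then show ?thesis using ny by (simp add: divide_le_0_iff)
qed simp

text \<open>A sequence in \<open>S\<close> minimizing the distance to \<open>x\<close> is Cauchy by
  the parallelogram law. Its limit \<open>p\<close> is a nearest point of \<open>S\<close>, and
  minimality makes \<open>x - p\<close> orthogonal to \<open>S\<close>.\<close>

lemma orthogonal_decomposition:
  fixes S :: "'h::chilbert_space set"
  assumes S: "csubspace S" and cl: "closed S"
  obtains p q where "x = p + q" "p \<in> S" "q \<in> ortho_complement S"
proof -
  define d where "d = (INF y\<in>S. norm (x - y))"
  have bdd: "bdd_below ((\<lambda>y. norm (x - y)) ` S)" by (auto intro!: bdd_belowI[of _ 0])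
  have ne: "S \<noteq> {}" using csubspaceD(1)[OF S] by auto
  have d_le: "d \<le> norm (x - y)" if "y \<in> S" for y
    unfolding d_def by (rule cINF_lower[OF bdd that])
  have d0: "0 \<le> d" unfolding d_def using ne by (intro cINF_greatest) auto
  have "\<exists>y\<in>S. norm (x - y) < d + 1 / Suc n" for n
  proof -
    have "d < d + 1 / Suc n" by simp
    then show ?thesis unfolding d_def by (subst (asm) cINF_less_iff[OF ne bdd]) auto
  qed
  then obtain y where yS: "\<And>n. y n \<in> S" and y: "\<And>n. norm (x - y n) < d + 1 / Suc n"
    by metis
  have lim: "(\<lambda>n. norm (x - y n)) \<longlonglongrightarrow> d"
  proof (rule tendsto_sandwich[of "\<lambda>_. d" _ _ "\<lambda>n. d + 1 / Suc n"])
    show "(\<lambda>n. d + 1 / Suc n) \<longlonglongrightarrow> d"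
      using tendsto_add[OF tendsto_const[of d] LIMSEQ_inverse_real_of_nat]
      by (simp add: inverse_eq_divide)
  qed (use yS d_le y in \<open>auto intro!: always_eventually less_imp_le\<close>)
  \<comment> \<open>Parallelogram law for \<open>x - y n\<close> and \<open>x - y m\<close>: the
    midpoint of \<open>y n\<close> and \<open>y m\<close> lies in \<open>S\<close>, hence has
    distance at least \<open>d\<close> from \<open>x\<close>.\<close>
  have par: "(norm (y m - y n))\<^sup>2 \<le> 2 * (norm (x - y m))\<^sup>2 + 2 * (norm (x - y n))\<^sup>2 - 4 * d\<^sup>2" for m n
  proof -
    have "y m - y n = (x - y n) - (x - y m)" by simp
    then have 1: "(norm (y m - y n))\<^sup>2 =
        2 * (norm (x - y m))\<^sup>2 + 2 * (norm (x - y n))\<^sup>2 - (norm ((x - y n) + (x - y m)))\<^sup>2"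
      by (simp only: norm_diff_sq[of "x - y n" "x - y m"] norm_add_sq)
    have "(x - y n) + (x - y m) = 2 *\<^sub>R (x - (1/2) *\<^sub>R (y n + y m))"
      by (simp add: algebra_simps scaleR_2)
    then have "norm ((x - y n) + (x - y m)) = 2 * norm (x - (1/2) *\<^sub>R (y n + y m))"
      by simp
    moreover have "d \<le> norm (x - (1/2) *\<^sub>R (y n + y m))"
      by (intro d_le csubspaceD(2,4)[OF S] yS)
    ultimately have "2 * d \<le> norm ((x - y n) + (x - y m))" by simp
    then have "(2 * d)\<^sup>2 \<le> (norm ((x - y n) + (x - y m)))\<^sup>2"
      using d0 by (intro power_mono) auto
    then show ?thesis using 1 by simp
  qed
  have "Cauchy y"
  proof (rule metric_CauchyI)
    fix e :: real assume e: "0 < e"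
    have "(\<lambda>n. (norm (x - y n))\<^sup>2) \<longlonglongrightarrow> d\<^sup>2" by (intro tendsto_intros lim)
    \<comment> \<open>The slack is a quarter of \<open>e\<^sup>2\<close> since \<open>par\<close>
      doubles each of the two squared distances.\<close>
    moreover have "d\<^sup>2 < d\<^sup>2 + e\<^sup>2 / 4" using e by simp
    ultimately have "\<forall>\<^sub>F n in sequentially. (norm (x - y n))\<^sup>2 < d\<^sup>2 + e\<^sup>2 / 4"
      by (rule order_tendstoD(2))
    then obtain N where N: "\<And>n. n \<ge> N \<Longrightarrow> (norm (x - y n))\<^sup>2 < d\<^sup>2 + e\<^sup>2 / 4"
      by (auto simp: eventually_sequentially)
    have "dist (y m) (y n) < e" if "m \<ge> N" "n \<ge> N" for m n
    proof -
      have "(norm (y m - y n))\<^sup>2 < e\<^sup>2" using par[of m n] N[OF that(1)] N[OF that(2)] by simp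
      then show ?thesis using e by (simp add: dist_norm power2_less_imp_less)
    qed
    then show "\<exists>N. \<forall>m\<ge>N. \<forall>n\<ge>N. dist (y m) (y n) < e" by blast
  qed
  then obtain p where p: "y \<longlonglongrightarrow> p" by (auto simp: Cauchy_convergent_iff convergent_def)
  have pS: "p \<in> S" using closed_sequentially[OF cl] yS p by blast
  have "(\<lambda>n. norm (x - y n)) \<longlonglongrightarrow> norm (x - p)" by (intro tendsto_intros p)
  then have nd: "norm (x - p) = d" using lim LIMSEQ_unique by blast
  have "x - p \<in> ortho_complement S"
    unfolding ortho_complement_def
  proof safe
    fix z assume z: "z \<in> S"
    show "cinner (x - p) z = 0"
    proof (rule orthogonal_if_minimal)
      fix a
      have "p + a *\<^sub>C z \<in> S" by (intro csubspaceD(2,3)[OF S] pS z)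
      from d_le[OF this] show "norm (x - p) \<le> norm (x - p - a *\<^sub>C z)"
        by (simp add: nd diff_diff_eq)
    qed
  qed
  with pS show thesis by (intro that[of p "x - p"]) auto
qed

lemma ortho_complement_disjoint:
  "x \<in> S \<Longrightarrow> x \<in> ortho_complement S \<Longrightarrow> x = (0 :: 'h::complex_inner)"
  by (auto simp: ortho_complement_def cinner_eq_zero_iff)

text \<open>Split \<open>x\<close> in the double complement as \<open>p + q\<close> along
  \<open>S\<close>. Then \<open>q\<close> is orthogonal to both \<open>x\<close> and
  \<open>p\<close>, hence to itself.\<close>

lemma double_ortho_complement:
  fixes S :: "'h::chilbert_space set"
  assumes S: "csubspace S" "closed S"
  shows "ortho_complement (ortho_complement S) = S"
proof
  show "S \<subseteq> ortho_complement (ortho_complement S)"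
    using ortho_complement_swap by (fastforce simp: ortho_complement_def[of "ortho_complement S"])
  show "ortho_complement (ortho_complement S) \<subseteq> S"
  proof
    fix x assume x: "x \<in> ortho_complement (ortho_complement S)"
    obtain p q where pq: "x = p + q" "p \<in> S" "q \<in> ortho_complement S"
      by (rule orthogonal_decomposition[OF S])
    have "cinner x q = 0" using x pq(3) by (auto simp: ortho_complement_def)
    moreover have "cinner p q = 0" using ortho_complement_swap[OF pq(3,2)] .
    ultimately have "cinner q q = 0" by (simp add: pq(1) cinner_simps)
    then show "x \<in> S" using pq by (simp add: cinner_eq_zero_iff)
  qed
qed

section \<open>Closed linear spans\<close>

lemma cspan_superset: "x \<in> X \<Longrightarrow> x \<in> cspan X"
  unfolding cspan_def by (rule hull_inc)

lemma csubspace_cspan [simp]: "csubspace (cspan X)"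
  unfolding cspan_def by (rule hull_in) (auto simp: csubspace_def)

lemma csubspace_closure:
  assumes "csubspace (S :: 'h::complex_inner set)" shows "csubspace (closure S)"
  unfolding csubspace_def
proof safe
  show "0 \<in> closure S" using csubspaceD(1)[OF assms] closure_subset by blast
next
  fix x y assume "x \<in> closure S" "y \<in> closure S"
  then obtain f g where "\<And>n. f n \<in> S" "f \<longlonglongrightarrow> x" "\<And>n. g n \<in> S" "g \<longlonglongrightarrow> y"
    unfolding closure_sequential by blast
  then show "x + y \<in> closure S"
    unfolding closure_sequential
    by (intro exI[of _ "\<lambda>n. f n + g n"]) (auto intro: tendsto_add csubspaceD(2)[OF assms])
next
  fix a x assume "x \<in> closure S"
  then obtain f where "\<And>n. f n \<in> S" "f \<longlonglongrightarrow> x" unfolding closure_sequential by blast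
  then show "a *\<^sub>C x \<in> closure S"
    unfolding closure_sequential
    by (intro exI[of _ "\<lambda>n. a *\<^sub>C f n"])
      (auto intro: tendsto_scaleC[OF tendsto_const] csubspaceD(3)[OF assms])
qed

lemma cspan_minimal: "X \<subseteq> S \<Longrightarrow> csubspace S \<Longrightarrow> cspan X \<subseteq> S"
  unfolding cspan_def by (rule hull_minimal)

lemma ortho_complement_antimono: "X \<subseteq> Y \<Longrightarrow> ortho_complement Y \<subseteq> ortho_complement X"
  by (auto simp: ortho_complement_def)

text \<open>The double complement of \<open>X\<close> is a closed subspace containing
  \<open>X\<close>, so it also contains the closed span; whatever is orthogonal to \<open>X\<close>
  is therefore orthogonal to the closed span.\<close>

lemma ortho_complement_closure_cspan:
  fixes X :: "'h::chilbert_space set"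
  shows "ortho_complement (closure (cspan X)) = ortho_complement X"
proof
  show "ortho_complement (closure (cspan X)) \<subseteq> ortho_complement X"
    by (meson closure_subset cspan_superset ortho_complement_antimono subsetI subset_trans)
  have "X \<subseteq> ortho_complement (ortho_complement X)"
    using ortho_complement_swap by (fastforce simp: ortho_complement_def[of "ortho_complement X"])
  then have "closure (cspan X) \<subseteq> ortho_complement (ortho_complement X)"
    by (intro closure_minimal cspan_minimal) auto
  then show "ortho_complement X \<subseteq> ortho_complement (closure (cspan X))"
    using ortho_complement_swap by (fastforce simp: ortho_complement_def[of "closure (cspan X)"])
qed

text \<open>Reduces totality of an orthonormal set to a computation of its orthogonal complement,
  which is how the eigenvectors are recognized as a basis.\<close>

lemma closure_cspan_eq:
  fixes X :: "'h::chilbert_space set"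
  shows "closure (cspan X) = ortho_complement (ortho_complement X)"
  using double_ortho_complement[of "closure (cspan X)"]
  by (simp add: csubspace_closure ortho_complement_closure_cspan)


section \<open>Orthonormal expansions\<close>

lemma orthonormal_coeff:
  assumes "orthonormal F" "finite F" "e \<in> F"
  shows "cinner (\<Sum>x\<in>F. c x *\<^sub>C x) e = c (e :: 'h::complex_inner)"
proof -
  have "cinner (\<Sum>x\<in>F. c x *\<^sub>C x) e = (\<Sum>x\<in>F. if x = e then c e else 0)"
    unfolding cinner_sum_left
    by (rule sum.cong) (use assms in \<open>auto simp: cinner_simps orthonormal_def\<close>)
  also have "\<dots> = c e" using assms by simp
  finally show ?thesis .
qed

lemma orthonormal_residual:
  assumes "orthonormal F" "finite F"
  shows "x - (\<Sum>e\<in>F. cinner x e *\<^sub>C e) \<in> ortho_complement (F :: 'h::complex_inner set)"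
  using orthonormal_coeff[OF assms, of _ "cinner x"]
  by (auto simp: ortho_complement_def cinner_diff_left)

lemma pythagoras:
  "cinner x y = 0 \<Longrightarrow> (norm (x + y))\<^sup>2 = (norm x)\<^sup>2 + (norm (y :: 'h::complex_inner))\<^sup>2"
  by (simp add: norm_add_sq)

text \<open>The residual of the Fourier sum is orthogonal to the span of \<open>F\<close>, so by
  Pythagoras any other choice of coefficients adds the squared norm of the difference of the two
  sums.\<close>

lemma best_approximation:
  fixes x :: "'h::complex_inner"
  assumes F: "orthonormal F" "finite F"
  shows "norm (x - (\<Sum>e\<in>F. cinner x e *\<^sub>C e)) \<le> norm (x - (\<Sum>e\<in>F. c e *\<^sub>C e))"
proof -
  let ?r = "x - (\<Sum>e\<in>F. cinner x e *\<^sub>C e)"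
  let ?s = "\<Sum>e\<in>F. (cinner x e - c e) *\<^sub>C e"
  have "cinner ?r ?s = 0"
    using orthonormal_residual[OF F, of x]
    by (auto simp: cinner_sum_right cinner_scaleC_right ortho_complement_def intro!: sum.neutral)
  moreover have "?s = (\<Sum>e\<in>F. cinner x e *\<^sub>C e) - (\<Sum>e\<in>F. c e *\<^sub>C e)"
    by (simp add: scaleC_add_left scaleC_minus_left diff_conv_add_uminus sum.distrib sum_negf
        del: add_uminus_conv_diff)
  ultimately have "(norm (x - (\<Sum>e\<in>F. c e *\<^sub>C e)))\<^sup>2 = (norm ?r)\<^sup>2 + (norm ?s)\<^sup>2"
    using pythagoras[of ?r ?s] by simp
  then have "(norm ?r)\<^sup>2 \<le> (norm (x - (\<Sum>e\<in>F. c e *\<^sub>C e)))\<^sup>2" by simp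
  then show ?thesis by (rule power2_le_imp_le) simp
qed

lemma orthonormal_norm: "orthonormal X \<Longrightarrow> e \<in> X \<Longrightarrow> norm e = 1"
  by (simp add: orthonormal_def norm_eq_sqrt_cinner)

text \<open>For the Fourier sum \<open>?p\<close>, both \<open>cinner x ?p\<close> and
  \<open>cinner ?p ?p\<close> equal the sum of the squared coefficients, so that sum is the gap
  between the squared norms of \<open>x\<close> and \<open>x - ?p\<close>.\<close>

lemma bessel:
  fixes x :: "'h::complex_inner"
  assumes F: "orthonormal F" "finite F"
  shows "(\<Sum>e\<in>F. (cmod (cinner x e))\<^sup>2) \<le> (norm x)\<^sup>2"
proof -
  let ?p = "\<Sum>e\<in>F. cinner x e *\<^sub>C e"
  have "cinner x ?p = (\<Sum>e\<in>F. of_real ((cmod (cinner x e))\<^sup>2))"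
    by (simp add: cinner_sum_right cinner_scaleC_right complex_norm_square mult.commute
        del: of_real_power)
  moreover have "cinner ?p ?p = (\<Sum>e\<in>F. of_real ((cmod (cinner x e))\<^sup>2))"
    unfolding cinner_sum_right cinner_scaleC_right
    by (rule sum.cong)
      (simp_all add: orthonormal_coeff[OF F] complex_norm_square mult.commute del: of_real_power)
  ultimately have "(norm (x - ?p))\<^sup>2 = (norm x)\<^sup>2 - (\<Sum>e\<in>F. (cmod (cinner x e))\<^sup>2)"
    unfolding norm_diff_sq norm_sq_eq_cinner[of ?p] by simp
  then show ?thesis using zero_le_power2[of "norm (x - ?p)"] by linarith
qed

lemma cspan_finite_sum:
  assumes "x \<in> cspan (X :: 'h::complex_inner set)"
  obtains F c where "finite F" "F \<subseteq> X" "x = (\<Sum>e\<in>F. c e *\<^sub>C e)"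
proof -
  let ?S = "{x. \<exists>F c. finite F \<and> F \<subseteq> X \<and> x = (\<Sum>e\<in>F. c e *\<^sub>C e)}"
  have "csubspace ?S"
    unfolding csubspace_def
  proof (intro conjI ballI allI)
    show "0 \<in> ?S" by (auto intro!: exI[of _ "{}"])
  next
    fix x y assume "x \<in> ?S" "y \<in> ?S"
    then obtain F c G d where *: "finite F" "F \<subseteq> X" "x = (\<Sum>e\<in>F. c e *\<^sub>C e)"
      "finite G" "G \<subseteq> X" "y = (\<Sum>e\<in>G. d e *\<^sub>C e)" by blast
    \<comment> \<open>Extension of the coefficients by zero puts both combinations over the common
      index set \<open>F \<union> G\<close>.\<close>
    let ?c = "\<lambda>e. if e \<in> F then c e else 0" and ?d = "\<lambda>e. if e \<in> G then d e else 0"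
    have "x = (\<Sum>e\<in>F \<union> G. ?c e *\<^sub>C e)" "y = (\<Sum>e\<in>F \<union> G. ?d e *\<^sub>C e)"
      unfolding * by (rule sum.mono_neutral_cong_left; use * in auto)+
    then have "x + y = (\<Sum>e\<in>F \<union> G. (?c e + ?d e) *\<^sub>C e)"
      by (simp only: scaleC_add_left sum.distrib)
    then show "x + y \<in> ?S"
      using * by (intro CollectI exI[of _ "F \<union> G"] exI[of _ "\<lambda>e. ?c e + ?d e"]) auto
  next
    fix a x assume "x \<in> ?S"
    then obtain F c where *: "finite F" "F \<subseteq> X" "x = (\<Sum>e\<in>F. c e *\<^sub>C e)" by blast
    then have "a *\<^sub>C x = (\<Sum>e\<in>F. (a * c e) *\<^sub>C e)" by (simp add: scaleC_sum_right scaleC_scaleC)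
    then show "a *\<^sub>C x \<in> ?S"
      using * by (intro CollectI exI[of _ F] exI[of _ "\<lambda>e. a * c e"]) auto
  qed
  moreover have "X \<subseteq> ?S"
  proof
    fix x assume "x \<in> X"
    then show "x \<in> ?S" by (intro CollectI exI[of _ "{x}"] exI[of _ "\<lambda>_. 1"]) auto
  qed
  ultimately have "cspan X \<subseteq> ?S" by (intro cspan_minimal)
  then show thesis using assms that by blast
qed

lemma orthonormal_insert:
  assumes "orthonormal X" "e \<in> ortho_complement X" "norm e = 1"
  shows "orthonormal (insert e X)"
proof -
  have "cinner e x = 0" "cinner x e = 0" if "x \<in> X" for x
    using assms(2) that ortho_complement_swap by (auto simp: ortho_complement_def)
  moreover have "cinner e e = 1" using assms(3) by (simp add: cinner_self)
  ultimately show ?thesis using assms(1) by (auto simp: orthonormal_def)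
qed

lemma orthonormal_subset: "orthonormal X \<Longrightarrow> F \<subseteq> X \<Longrightarrow> orthonormal F"
  unfolding orthonormal_def by blast

text \<open>Some finite combination \<open>s\<close> over a set \<open>F\<close> is within
  \<open>r\<close> of \<open>x\<close>. For every finite \<open>G\<close> containing
  \<open>F\<close>, \<open>s\<close> is also a combination over \<open>G\<close>, so the Fourier sum
  over \<open>G\<close> is at least as close to \<open>x\<close>.\<close>

lemma orthonormal_expansion:
  fixes x :: "'h::complex_inner"
  assumes X: "orthonormal X" and x: "x \<in> closure (cspan X)"
  shows "((\<lambda>e. cinner x e *\<^sub>C e) has_sum x) X"
  unfolding has_sum_def
proof (rule tendstoI)
  fix r :: real assume "0 < r"
  then obtain s where s: "s \<in> cspan X" "dist s x < r"
    using x by (auto simp: closure_approachable)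
  obtain F c where F: "finite F" "F \<subseteq> X" "s = (\<Sum>e\<in>F. c e *\<^sub>C e)"
    by (rule cspan_finite_sum[OF s(1)])
  have "dist (\<Sum>e\<in>G. cinner x e *\<^sub>C e) x < r" if G: "finite G" "F \<subseteq> G" "G \<subseteq> X" for G
  proof -
    have "s = (\<Sum>e\<in>G. (if e \<in> F then c e else 0) *\<^sub>C e)"
      unfolding F(3) by (rule sum.mono_neutral_cong_left) (use F G in auto)
    then have "norm (x - (\<Sum>e\<in>G. cinner x e *\<^sub>C e)) \<le> norm (x - s)"
      using best_approximation[OF orthonormal_subset[OF X G(3)] G(1), of x] by simp
    then show ?thesis using s(2) by (simp add: dist_norm norm_minus_commute)
  qed
  then show "\<forall>\<^sub>F G in finite_subsets_at_top X. dist (\<Sum>e\<in>G. cinner x e *\<^sub>C e) x < r"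
    unfolding eventually_finite_subsets_at_top using F by blast
qed


section \<open>Positive operators of finite trace\<close>

text \<open>The interface between probability and operator theory: these properties of the
  auto-covariance operator are all that the spectral part and the study of the generalized inverse
  rely on. The trace bound takes the place of compactness.\<close>

locale positive_trace_class =
  fixes A :: "'h::chilbert_space \<Rightarrow> 'h" and C :: real
  assumes add: "A (x + y) = A x + A y"
    and scaleC: "A (a *\<^sub>C x) = a *\<^sub>C A x"
    and symmetric: "cinner (A x) y = cinner x (A y)"
    and positive: "0 \<le> Re (cinner (A x) x)"
    and trace_bound: "finite F \<Longrightarrow> orthonormal F \<Longrightarrow> (\<Sum>e\<in>F. Re (cinner (A e) e)) \<le> C"
begin

section \<open>Linearity, continuity and kernel of the operator\<close>

lemma scaleR: "A (r *\<^sub>R x) = r *\<^sub>R A x"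
  by (simp add: scaleR_scaleC scaleC)

lemma zero: "A 0 = 0"
  using scaleR[of 0 0] by simp

lemma minus: "A (- x) = - A x"
  using scaleR[of "-1" x] by simp

lemma diff: "A (x - y) = A x - A y"
  using add[of x "-y"] by (simp add: minus)

lemma C_nonneg: "0 \<le> C"
  using trace_bound[of "{}"] by (simp add: orthonormal_def)

lemma form_normalize: "Re (cinner (A x) x) = (norm x)\<^sup>2 * Re (cinner (A (sgn x)) (sgn x))"
  by (cases "x = 0") (simp_all add: sgn_div_norm scaleR cinner_simps field_simps power2_eq_square)

lemma form_le_if_sgn:
  "Re (cinner (A (sgn x)) (sgn x)) \<le> m \<Longrightarrow> Re (cinner (A x) x) \<le> m * (norm x)\<^sup>2"
  by (subst form_normalize, subst mult.commute) (rule mult_right_mono, auto)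

lemma orthonormal_sgn: "x \<noteq> 0 \<Longrightarrow> orthonormal {sgn x}"
  by (auto simp: orthonormal_def cinner_self norm_sgn)

lemma form_bound: "Re (cinner (A x) x) \<le> C * (norm x)\<^sup>2"
proof (cases "x = 0")
  case False
  then have "Re (cinner (A (sgn x)) (sgn x)) \<le> C"
    using trace_bound[of "{sgn x}"] orthonormal_sgn[of x] by simp
  then show ?thesis
    by (rule form_le_if_sgn)
qed (simp add: zero)

lemma form_cauchy_schwarz:
  "(cmod (cinner (A x) y))\<^sup>2 \<le> Re (cinner (A x) x) * Re (cinner (A y) y)"
  by (rule cauchy_schwarz_of_semidefinite[where W = UNIV])
    (auto simp: add scaleC cinner_simps csubspace_def positive,
      metis symmetric cinner_commute)

text \<open>Cauchy-Schwarz for the form, with \<open>A x\<close> as second argument, bounds the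
  fourth power of \<open>norm (A x)\<close> by zero.\<close>

lemma form_zero: "Re (cinner (A x) x) = 0 \<Longrightarrow> A x = 0"
  using form_cauchy_schwarz[of x "A x"] by (simp add: cinner_eq_zero_iff)

text \<open>Cauchy-Schwarz for the form with \<open>A x\<close> as second argument, both factors
  then being estimated by \<open>form_bound\<close>; one factor \<open>norm (A x)\<close>
  cancels.\<close>

lemma norm_bound: "norm (A x) \<le> C * norm x"
proof -
  have "((norm (A x))\<^sup>2)\<^sup>2 \<le> Re (cinner (A x) x) * Re (cinner (A (A x)) (A x))"
    using form_cauchy_schwarz[of x "A x"] by (simp add: cinner_self norm_power)
  also have "\<dots> \<le> (C * (norm x)\<^sup>2) * (C * (norm (A x))\<^sup>2)"
    by (intro mult_mono form_bound positive mult_nonneg_nonneg C_nonneg zero_le_power2)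
  also have "\<dots> = (C * norm x * norm (A x))\<^sup>2" by (simp add: power2_eq_square)
  finally have "(norm (A x))\<^sup>2 \<le> C * norm x * norm (A x)"
    by (rule power2_le_imp_le) (simp add: C_nonneg)
  then show ?thesis by (cases "A x = 0") (simp_all add: power2_eq_square C_nonneg)
qed

lemma bounded_linear: "bounded_linear A"
  by (rule bounded_linear_intro[of A C])
    (simp_all add: add scaleR norm_bound mult.commute)

lemma csubspace_kernel: "csubspace (kernel A)"
  by (auto simp: csubspace_def kernel_def zero add scaleC)

lemma closed_kernel: "closed (kernel A)"
  unfolding kernel_def
  by (intro closed_Collect_eq continuous_on_const linear_continuous_on bounded_linear)

lemma range_orthogonal_kernel: "y \<in> kernel A \<Longrightarrow> cinner (A x) y = 0"
  by (simp add: symmetric kernel_def)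


subsection \<open>Eigenvectors\<close>

text \<open>By the trace bound, an orthonormal family on which the form exceeds \<open>m\<close> has
  at most \<open>C / m\<close> members, so one of maximal cardinality exists. A unit vector of
  \<open>W\<close> orthogonal to it with form above \<open>m\<close> would enlarge it. Thus the form
  is at most \<open>m\<close> off a finite-dimensional space.\<close>

lemma maximal_large_family:
  assumes W: "csubspace W" and m: "0 < m"
  obtains F where "finite F" "orthonormal F" "F \<subseteq> W"
    "\<And>x. x \<in> W \<Longrightarrow> x \<in> ortho_complement F \<Longrightarrow> Re (cinner (A x) x) \<le> m * (norm x)\<^sup>2"
proof -
  define P where "P F \<longleftrightarrow> finite F \<and> orthonormal F \<and> F \<subseteq> W \<and> (\<forall>e\<in>F. m < Re (cinner (A e) e))" for F
  have bd: "card F \<le> nat \<lceil>C / m\<rceil>" if "P F" for F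
  proof -
    have "real (card F) * m = (\<Sum>e\<in>F. m)" by simp
    also have "\<dots> \<le> (\<Sum>e\<in>F. Re (cinner (A e) e))"
      using that by (intro sum_mono) (auto simp: P_def intro: less_imp_le)
    also have "\<dots> \<le> C" using that trace_bound by (auto simp: P_def)
    finally have "real (card F) \<le> C / m" using m by (simp add: field_simps)
    then show ?thesis by linarith
  qed
  have "P {}" by (simp add: P_def orthonormal_def)
  with bd have "\<exists>F. P F \<and> (\<forall>G. P G \<longrightarrow> card G \<le> card F)"
    by (intro ex_has_greatest_nat[where b = "Suc (nat \<lceil>C / m\<rceil>)"]) (simp_all add: less_Suc_eq_le)
  then obtain F where F: "P F" and max: "\<And>G. P G \<Longrightarrow> card G \<le> card F" by blast
  have "Re (cinner (A x) x) \<le> m * (norm x)\<^sup>2" if x: "x \<in> W" "x \<in> ortho_complement F" for x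
  proof (cases "x = 0")
    case False
    let ?e = "sgn x"
    have eW: "?e \<in> W" unfolding sgn_div_norm by (rule csubspaceD(4)[OF W x(1)])
    have eF: "?e \<in> ortho_complement F"
      unfolding sgn_div_norm by (rule csubspaceD(4)[OF csubspace_ortho_complement x(2)])
    have ne: "norm ?e = 1" using False by (simp add: norm_sgn)
    have "Re (cinner (A ?e) ?e) \<le> m"
    proof (rule ccontr)
      assume "\<not> Re (cinner (A ?e) ?e) \<le> m"
      moreover have "orthonormal (insert ?e F)"
        using F eF ne by (intro orthonormal_insert) (simp_all add: P_def)
      ultimately have "P (insert ?e F)" using F eW by (simp add: P_def not_le)
      \<comment> \<open>Maximality forbids a larger cardinality, so \<open>?e\<close> already
        belongs to \<open>F\<close>, although it is a unit vector orthogonal to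
        \<open>F\<close>.\<close>
      from max[OF this] have "?e \<in> F"
        using F card_insert_disjoint[of F ?e] unfolding P_def by linarith
      from ortho_complement_disjoint[OF this eF] show False using ne by simp
    qed
    then show ?thesis
      by (rule form_le_if_sgn)
  qed (simp add: zero)
  with that[of F] F show thesis by (simp add: P_def)
qed

text \<open>Adding a vector \<open>e\<close> turns the set into the continuous image of the product
  of the closed unit disc with the previous set.\<close>

lemma compact_combinations:
  "finite F \<Longrightarrow> compact {\<Sum>e\<in>F. c e *\<^sub>C (e::'h) |c. \<forall>e\<in>F. cmod (c e) \<le> 1}"
proof (induction F rule: finite_induct)
  case (insert e F)
  let ?K = "{\<Sum>e\<in>F. c e *\<^sub>C (e::'h) |c. \<forall>e\<in>F. cmod (c e) \<le> 1}"
  have "{\<Sum>x\<in>insert e F. c x *\<^sub>C (x::'h) |c. \<forall>x\<in>insert e F. cmod (c x) \<le> 1} =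
      (\<lambda>(a, y). a *\<^sub>C e + y) ` (cball 0 1 \<times> ?K)" (is "?L = ?R")
  proof
    show "?L \<subseteq> ?R" using insert by (force simp: image_iff)
    show "?R \<subseteq> ?L"
    proof clarify
      fix a :: complex and c :: "'h \<Rightarrow> complex"
      assume a: "a \<in> cball 0 1" and c: "\<forall>x\<in>F. cmod (c x) \<le> 1"
      have "(\<Sum>x\<in>F. (c(e := a)) x *\<^sub>C x) = (\<Sum>x\<in>F. c x *\<^sub>C x)"
        using insert by (intro sum.cong) auto
      then have "a *\<^sub>C e + (\<Sum>x\<in>F. c x *\<^sub>C x) = (\<Sum>x\<in>insert e F. (c(e := a)) x *\<^sub>C x)"
        using insert by simp
      then show "\<exists>c'. a *\<^sub>C e + (\<Sum>x\<in>F. c x *\<^sub>C x) = (\<Sum>x\<in>insert e F. c' x *\<^sub>C x) \<and>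
          (\<forall>x\<in>insert e F. cmod (c' x) \<le> 1)"
        using a c by (intro exI[of _ "c(e := a)"]) auto
    qed
  qed
  moreover have "compact \<dots>"
    by (intro compact_continuous_image compact_Times insert compact_cball)
      (auto simp: case_prod_unfold intro!: continuous_intros)
  ultimately show ?case by simp
qed simp

text \<open>A maximizing sequence of the quadratic form splits into a part in a finite-dimensional space and
  a part on which \<open>m - A\<close> is bounded below, \<open>m\<close> being the supremum. The first has a convergent
  subsequence by compactness; the second is then Cauchy, since \<open>m - A\<close> tends to zero along the
  maximizing sequence.\<close>

lemma eigenvector_in_invariant_subspace:
  assumes W: "csubspace W" "closed W" and inv: "\<And>x. x \<in> W \<Longrightarrow> A x \<in> W"
    and nz: "w \<in> W" "A w \<noteq> 0"
  obtains e m where "e \<in> W" "norm e = 1" "0 < m" "A e = m *\<^sub>R e"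
proof -
  define S where "S = {x \<in> W. norm x = 1}"
  define m where "m = (SUP x\<in>S. Re (cinner (A x) x))"
  have bdd: "bdd_above ((\<lambda>x. Re (cinner (A x) x)) ` S)"
  proof (rule bdd_aboveI2)
    show "Re (cinner (A x) x) \<le> C" if "x \<in> S" for x
      using form_bound[of x] that by (simp add: S_def)
  qed
  have sgnS: "sgn x \<in> S" if "x \<in> W" "x \<noteq> 0" for x
    using that csubspaceD(4)[OF W(1)] by (auto simp: S_def norm_sgn sgn_div_norm)
  have w0: "w \<noteq> 0" using nz zero by auto
  have ne: "S \<noteq> {}" using sgnS[OF nz(1) w0] by auto
  have le_m: "Re (cinner (A x) x) \<le> m * (norm x)\<^sup>2" if "x \<in> W" for x
  proof (cases "x = 0")
    case False
    have "Re (cinner (A (sgn x)) (sgn x)) \<le> m"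
      unfolding m_def by (rule cSUP_upper[OF sgnS[OF that False] bdd])
    then show ?thesis by (rule form_le_if_sgn)
  qed (simp add: zero)
  have "0 < m"
  proof -
    have "0 < Re (cinner (A w) w)" using form_zero nz(2) positive[of w] by force
    then have "0 < m * (norm w)\<^sup>2" using le_m[OF nz(1)] by linarith
    then show ?thesis using w0 by (simp add: zero_less_mult_iff)
  qed
  define B where "B x = m *\<^sub>R x - A x" for x
  have BW: "B x \<in> W" if "x \<in> W" for x
    unfolding B_def by (intro csubspaceD(4,6)[OF W(1)] that inv)
  have form_B: "Re (cinner (B x) x) = m * (norm x)\<^sup>2 - Re (cinner (A x) x)" for x
    by (simp add: B_def cinner_simps cinner_self)
  have blB: "bounded_linear B"
    unfolding B_def by (intro bounded_linear_sub bounded_linear_scaleR_right bounded_linear)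
  \<comment> \<open>Makes \<open>B x\<close> small when the form of \<open>A\<close> at a unit
    vector \<open>x\<close> is close to \<open>m\<close>. Cauchy-Schwarz is applied to the form of
    \<open>B\<close> on \<open>W\<close>; positivity of \<open>A\<close> bounds the form of
    \<open>B\<close> at \<open>B x\<close> by \<open>m * (norm (B x))\<^sup>2\<close>.\<close>
  have normB: "(norm (B x))\<^sup>2 \<le> m * Re (cinner (B x) x)" if x: "x \<in> W" for x
  proof -
    have "(cmod (cinner (B x) (B x)))\<^sup>2 \<le> Re (cinner (B x) x) * Re (cinner (B (B x)) (B x))"
    proof (rule cauchy_schwarz_of_semidefinite[where W = W])
      show "cinner (B x) y = cnj (cinner (B y) x)" for x y
        by (metis B_def cinner_commute cinner_diff_left cinner_diff_right cinner_scaleR_left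
            cinner_scaleR_right symmetric)
    qed (use x BW W le_m in \<open>auto simp: form_B, auto simp: B_def add scaleC cinner_simps algebra_simps\<close>)
    also have "\<dots> \<le> Re (cinner (B x) x) * (m * (norm (B x))\<^sup>2)"
      using le_m[OF x] positive[of "B x"] by (intro mult_left_mono) (simp_all add: form_B)
    finally have "(norm (B x))\<^sup>2 * (norm (B x))\<^sup>2 \<le> (m * Re (cinner (B x) x)) * (norm (B x))\<^sup>2"
      by (simp add: cinner_self norm_power power2_eq_square[of "(norm (B x))\<^sup>2"] mult_ac)
    then show ?thesis
    proof (cases "B x = 0")
      case False
      then have "0 < (norm (B x))\<^sup>2" by simp
      with \<open>_ \<le> m * Re (cinner (B x) x) * (norm (B x))\<^sup>2\<close> show ?thesis
        by (rule mult_right_le_imp_le)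
    qed simp
  qed
  have "\<exists>x\<in>S. m - 1 / Suc n < Re (cinner (A x) x)" for n
  proof -
    have "m - 1 / Suc n < m" by simp
    then show ?thesis unfolding m_def by (subst (asm) less_cSUP_iff[OF ne bdd]) auto
  qed
  then obtain x where xS: "\<And>n. x n \<in> S" and x: "\<And>n. m - 1 / Suc n < Re (cinner (A (x n)) (x n))"
    by metis
  have xW: "x n \<in> W" and nx: "norm (x n) = 1" for n using xS[of n] by (auto simp: S_def)
  have "(\<lambda>n. (norm (B (x n)))\<^sup>2) \<longlonglongrightarrow> 0"
  proof (rule tendsto_sandwich[of "\<lambda>_. 0" _ _ "\<lambda>n. m * inverse (Suc n)"])
    have "(norm (B (x n)))\<^sup>2 \<le> m * inverse (Suc n)" for n
    proof -
      have "Re (cinner (B (x n)) (x n)) \<le> inverse (Suc n)"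
        using x[of n] by (simp add: form_B nx inverse_eq_divide)
      then show ?thesis
        using normB[OF xW] \<open>0 < m\<close> by (meson mult_left_mono order_trans less_imp_le)
    qed
    then show "\<forall>\<^sub>F n in sequentially. (norm (B (x n)))\<^sup>2 \<le> m * inverse (Suc n)" by simp
    show "(\<lambda>n. m * inverse (Suc n)) \<longlonglongrightarrow> 0"
      by (intro tendsto_mult_right_zero LIMSEQ_inverse_real_of_nat)
  qed auto
  then have "(\<lambda>n. sqrt ((norm (B (x n)))\<^sup>2)) \<longlonglongrightarrow> sqrt 0" by (rule tendsto_real_sqrt)
  then have Bx: "(\<lambda>n. B (x n)) \<longlonglongrightarrow> 0" by (simp add: tendsto_norm_zero_iff)
  \<comment> \<open>The threshold \<open>m/2\<close> lies strictly below the supremum. The gap makes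
    \<open>B\<close> bounded below by \<open>m/2\<close> on the vectors of \<open>W\<close>
    orthogonal to \<open>F\<close>.\<close>
  obtain F where F: "finite F" "orthonormal F" "F \<subseteq> W"
    and small: "\<And>x. x \<in> W \<Longrightarrow> x \<in> ortho_complement F \<Longrightarrow> Re (cinner (A x) x) \<le> m/2 * (norm x)\<^sup>2"
    using maximal_large_family[OF W(1), of "m/2"] \<open>0 < m\<close> by auto
  define p where "p n = (\<Sum>e\<in>F. cinner (x n) e *\<^sub>C e)" for n
  let ?K = "{\<Sum>e\<in>F. c e *\<^sub>C e |c. \<forall>e\<in>F. cmod (c e) \<le> 1}"
  have "p n \<in> ?K" for n
  proof -
    have "cmod (cinner (x n) e) \<le> 1" if "e \<in> F" for e
      using cauchy_schwarz[of "x n" e] nx orthonormal_norm[OF F(2) that] by simp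
    then show ?thesis by (auto simp: p_def intro!: exI[of _ "cinner (x n)"])
  qed
  then obtain r p' where r: "strict_mono r" and p': "(p \<circ> r) \<longlonglongrightarrow> p'"
    using compact_combinations[OF F(1)] unfolding compact_def by meson
  define z where "z n = x (r n) - p (r n)" for n
  have pW: "p n \<in> W" for n
    unfolding p_def by (intro csubspace_sum[OF W(1)] csubspaceD(3)[OF W(1)]) (use F in auto)
  have zW: "z n \<in> W" for n unfolding z_def by (intro csubspaceD(6)[OF W(1)] xW pW)
  have zF: "z n \<in> ortho_complement F" for n
    unfolding z_def p_def by (rule orthonormal_residual[OF F(2,1)])
  have coercive: "m/2 * norm y \<le> norm (B y)" if "y \<in> W" "y \<in> ortho_complement F" for y
  proof -
    have "m/2 * (norm y)\<^sup>2 \<le> Re (cinner (B y) y)" using small[OF that] by (simp add: form_B)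
    also have "\<dots> \<le> norm (B y) * norm y"
      using cauchy_schwarz[of "B y" y] complex_Re_le_cmod order_trans by blast
    finally show ?thesis by (cases "y = 0") (simp_all add: power2_eq_square)
  qed
  have "(\<lambda>n. B (z n)) \<longlonglongrightarrow> 0 - B p'"
  proof -
    have "(\<lambda>n. B (x (r n)) - B (p (r n))) \<longlonglongrightarrow> 0 - B p'"
      using LIMSEQ_subseq_LIMSEQ[OF Bx r] bounded_linear.tendsto[OF blB p']
      by (intro tendsto_diff) (simp_all add: o_def)
    then show ?thesis by (simp add: z_def linear_diff[OF bounded_linear.linear[OF blB]])
  qed
  then have CB: "Cauchy (\<lambda>n. B (z n))" by (rule LIMSEQ_imp_Cauchy)
  have "Cauchy z"
  proof (rule metric_CauchyI)
    fix e :: real assume "0 < e"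
    then have "0 < m/2 * e" using \<open>0 < m\<close> by simp
    from metric_CauchyD[OF CB this] obtain N
      where N: "\<And>i j. i \<ge> N \<Longrightarrow> j \<ge> N \<Longrightarrow> dist (B (z i)) (B (z j)) < m/2 * e" by blast
    have "dist (z i) (z j) < e" if "i \<ge> N" "j \<ge> N" for i j
    proof -
      have "m/2 * norm (z i - z j) \<le> norm (B (z i - z j))"
        by (intro coercive csubspaceD(6)[OF W(1)] csubspaceD(6)[OF csubspace_ortho_complement] zW zF)
      also have "\<dots> = dist (B (z i)) (B (z j))"
        by (simp add: dist_norm linear_diff[OF bounded_linear.linear[OF blB]])
      also have "\<dots> < m/2 * e" using N that by blast
      finally show ?thesis using \<open>0 < m\<close> by (simp add: dist_norm)
    qed
    then show "\<exists>N. \<forall>i\<ge>N. \<forall>j\<ge>N. dist (z i) (z j) < e" by blast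
  qed
  then obtain z' where "z \<longlonglongrightarrow> z'" by (auto simp: Cauchy_convergent_iff convergent_def)
  then have "(\<lambda>n. z n + p (r n)) \<longlonglongrightarrow> z' + p'"
    using p' by (intro tendsto_add) (simp_all add: o_def)
  then have lim: "(\<lambda>n. x (r n)) \<longlonglongrightarrow> z' + p'" by (simp add: z_def)
  have "z' + p' \<in> W" using closed_sequentially[OF W(2) _ lim] xW by blast
  moreover have "norm (z' + p') = 1"
    using tendsto_norm[OF lim] by (simp add: nx LIMSEQ_const_iff)
  moreover have "B (z' + p') = 0"
    using bounded_linear.tendsto[OF blB lim] LIMSEQ_subseq_LIMSEQ[OF Bx r] LIMSEQ_unique
    by (fastforce simp: o_def)
  ultimately show thesis using \<open>0 < m\<close> that[of "z' + p'" m] by (simp add: B_def)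
qed

text \<open>Zorn's lemma gives a maximal orthonormal set \<open>X\<close> of eigenvectors with
  positive eigenvalues. Its complement is invariant, and \<open>A\<close> vanishes there, since
  otherwise it would contain a further eigenvector; so the complement is the kernel. The trace bound
  leaves finitely many eigenvalues above each positive threshold, whence countability.\<close>

lemma exists_eigenbasis: "\<exists>X l. eigenbasis A X l"
proof -
  define \<X> where "\<X> = {X. orthonormal X \<and> (\<forall>x\<in>X. \<exists>l>0. A x = l *\<^sub>R x)}"
  have "\<Union>\<C> \<in> \<X>" if "subset.chain \<X> \<C>" for \<C>
  proof -
    have "orthonormal (\<Union>\<C>)"
      unfolding orthonormal_def
    proof (intro ballI)
      fix x y assume "x \<in> \<Union>\<C>" "y \<in> \<Union>\<C>"
      then obtain X Y where "X \<in> \<C>" "x \<in> X" "Y \<in> \<C>" "y \<in> Y" by blast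
      moreover from this have "X \<subseteq> Y \<or> Y \<subseteq> X" using that unfolding subset_chain_def by blast
      ultimately obtain Z where Z: "Z \<in> \<C>" "x \<in> Z" "y \<in> Z" by blast
      then have "Z \<in> \<X>" using that unfolding subset_chain_def by blast
      then show "cinner x y = (if x = y then 1 else 0)"
        using Z(2,3) unfolding \<X>_def orthonormal_def by blast
    qed
    moreover have "\<forall>x\<in>\<Union>\<C>. \<exists>l>0. A x = l *\<^sub>R x"
      using that unfolding subset_chain_def \<X>_def by blast
    ultimately show ?thesis by (simp add: \<X>_def)
  qed
  moreover have "{} \<in> \<X>" by (simp add: \<X>_def orthonormal_def)
  ultimately obtain X where X: "X \<in> \<X>" and max: "\<And>Y. Y \<in> \<X> \<Longrightarrow> X \<subseteq> Y \<Longrightarrow> Y = X"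
    using subset_Zorn_nonempty[of \<X>] by blast
  have on: "orthonormal X" using X by (simp add: \<X>_def)
  \<comment> \<open>On a unit eigenvector with positive eigenvalue this norm is the eigenvalue, so
    no choice function is required.\<close>
  define l where "l x = norm (A x)" for x
  have l: "0 < l x" "A x = l x *\<^sub>R x" if "x \<in> X" for x
    using X that orthonormal_norm[OF on that] by (auto simp: \<X>_def l_def)
  have inv: "A w \<in> ortho_complement X" if "w \<in> ortho_complement X" for w
    using that l(2) by (auto simp: ortho_complement_def symmetric cinner_scaleR_right)
  have "A w = 0" if w: "w \<in> ortho_complement X" for w
  proof (rule ccontr)
    assume "A w \<noteq> 0"
    then obtain e m where e: "e \<in> ortho_complement X" "norm e = 1" "0 < m" "A e = m *\<^sub>R e"
      using eigenvector_in_invariant_subspace[of "ortho_complement X" w] inv w by auto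
    have "insert e X \<in> \<X>"
      using X e orthonormal_insert[OF on e(1,2)] unfolding \<X>_def by blast
    then have "e \<in> X" using max by blast
    then show False using ortho_complement_disjoint[OF _ e(1)] e(2) by auto
  qed
  moreover have "cinner n x = 0" if "A n = 0" "x \<in> X" for n x
    using symmetric[of n x] that l[OF that(2)] by (simp add: cinner_scaleR_right)
  ultimately have "kernel A = ortho_complement X"
    by (auto simp: kernel_def ortho_complement_def)
  then have "is_onb_of X (ortho_complement (kernel A))"
    using on by (simp add: is_onb_of_def closure_cspan_eq)
  moreover have "countable X"
  proof -
    have fin: "finite {x\<in>X. 1 / Suc n < l x}" (is "finite ?Y") for n
    proof (rule ccontr)
      assume "infinite ?Y"
      \<comment> \<open>The cardinality exceeds \<open>C * Suc n\<close>, while each member of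
        \<open>G\<close> contributes at least \<open>1 / Suc n\<close> to the trace.\<close>
      then obtain G where G: "finite G" "card G = Suc (nat \<lceil>C * Suc n\<rceil>)" "G \<subseteq> ?Y"
        using infinite_arbitrarily_large by blast
      have "card G * (1 / Suc n) = (\<Sum>e\<in>G. 1 / Suc n)" by simp
      also have "\<dots> \<le> (\<Sum>e\<in>G. Re (cinner (A e) e))"
      proof (rule sum_mono)
        fix e assume "e \<in> G"
        then show "1 / Suc n \<le> Re (cinner (A e) e)"
          using G(3) l(2)[of e] orthonormal_norm[OF on, of e]
          by (auto simp: cinner_scaleR_left cinner_self)
      qed
      also have "\<dots> \<le> C"
        by (intro trace_bound G orthonormal_subset[OF on]) (use G in auto)
      finally have "real (card G) \<le> C * Suc n" by (simp add: field_simps)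
      then show False unfolding G(2) by linarith
    qed
    have "countable (\<Union>n. {x\<in>X. 1 / Suc n < l x})"
      by (intro countable_UN countable_finite fin countableI_type)
    moreover have "X \<subseteq> (\<Union>n. {x\<in>X. 1 / Suc n < l x})"
    proof
      fix x assume "x \<in> X"
      moreover obtain n where "1 / Suc n < l x"
        using reals_Archimedean[OF l(1)[OF \<open>x \<in> X\<close>]] by (auto simp: inverse_eq_divide)
      ultimately show "x \<in> (\<Union>n. {x\<in>X. 1 / Suc n < l x})" by blast
    qed
    ultimately show ?thesis by (rule countable_subset[rotated])
  qed
  ultimately have "eigenbasis A X l" using l by (simp add: eigenbasis_def)
  then show ?thesis by blast
qed


section \<open>The generalized inverse\<close>

lemma ginv_domainI: "b \<in> kernel A \<Longrightarrow> u = A a + b \<Longrightarrow> u \<in> ginv_domain A"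
  unfolding ginv_domain_def by blast

text \<open>Each basis vector \<open>x\<close> is orthogonal to \<open>u - A g\<close>, so
  \<open>cinner u x\<close> is \<open>l x\<close> times \<open>cinner g x\<close>. The series
  defining \<open>ginv A u\<close> is therefore the orthonormal expansion of \<open>g\<close>,
  whichever eigenbasis was chosen.\<close>

lemma ginv_eqI:
  assumes g: "g \<in> ortho_complement (kernel A)" and u: "u - A g \<in> kernel A"
  shows "u \<in> ginv_domain A" "ginv A u = g"
proof -
  show "u \<in> ginv_domain A"
    using u by (rule ginv_domainI[of _ _ g]) simp
  obtain X l where eb: "eigenbasis A X l"
    and def: "(SOME (X, l). eigenbasis A X l) = (X, l)"
  proof -
    have "\<exists>p. (case p of (X, l) \<Rightarrow> eigenbasis A X l)" using exists_eigenbasis by auto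
    from someI_ex[OF this] show thesis using that by (cases "SOME (X, l). eigenbasis A X l") auto
  qed
  have on: "orthonormal X" and cl: "closure (cspan X) = ortho_complement (kernel A)"
    and l: "\<And>x. x \<in> X \<Longrightarrow> 0 < l x" "\<And>x. x \<in> X \<Longrightarrow> A x = l x *\<^sub>R x"
    using eb by (auto simp: eigenbasis_def is_onb_of_def)
  have "inverse (l x) *\<^sub>R cinner u x *\<^sub>C x = cinner g x *\<^sub>C x" if x: "x \<in> X" for x
  proof -
    have "x \<in> ortho_complement (kernel A)"
      using x cl closure_subset cspan_superset by blast
    then have "cinner (u - A g) x = 0" using u ortho_complement_swap by blast
    then have "cinner u x = of_real (l x) * cinner g x"
      using l(2)[OF x] by (simp add: cinner_simps symmetric)
    then show ?thesis using l(1)[OF x] by (simp add: scaleR_scaleC scaleC_scaleC field_simps)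
  qed
  then have "((\<lambda>x. inverse (l x) *\<^sub>R cinner u x *\<^sub>C x) has_sum g) X"
    using orthonormal_expansion[OF on, of g] g cl by (simp cong: has_sum_cong)
  then show "ginv A u = g" unfolding ginv_def def by (simp add: infsumI)
qed

text \<open>Converse of \<open>ginv_eqI\<close>: removing the kernel component from a preimage
  leaves its image unchanged and moves it into the complement of the kernel.\<close>

lemma ginv_domainE:
  assumes "u \<in> ginv_domain A"
  shows "ginv A u \<in> ortho_complement (kernel A)" "u - A (ginv A u) \<in> kernel A"
proof -
  obtain a b where u: "u = A a + b" "b \<in> kernel A" using assms by (auto simp: ginv_domain_def)
  obtain p q where pq: "a = p + q" "p \<in> kernel A" "q \<in> ortho_complement (kernel A)"
    by (rule orthogonal_decomposition[OF csubspace_kernel closed_kernel])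
  have "A a = A q" using pq by (simp add: add kernel_def)
  then have "u - A q \<in> kernel A" using u by simp
  then show "ginv A u \<in> ortho_complement (kernel A)" "u - A (ginv A u) \<in> kernel A"
    using ginv_eqI[OF pq(3)] pq(3) by auto
qed

lemma ginv_graph:
  "{(u, ginv A u) |u. u \<in> ginv_domain A} =
    {(u, g). g \<in> ortho_complement (kernel A) \<and> u - A g \<in> kernel A}"
proof safe
  fix u g assume "g \<in> ortho_complement (kernel A)" "u - A g \<in> kernel A"
  then show "\<exists>v. (u, g) = (v, ginv A v) \<and> v \<in> ginv_domain A" using ginv_eqI[of g u] by simp
qed (simp_all add: ginv_domainE)

section \<open>Linearity, closedness, density and unboundedness\<close>

lemma linear_ginv: "linear_operator (ginv_domain A) (ginv A)"
proof -
  note K = csubspaceD[OF csubspace_kernel]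
    and P = csubspaceD[OF csubspace_ortho_complement[of "kernel A"]]
  have "x + y \<in> ginv_domain A \<and> ginv A (x + y) = ginv A x + ginv A y"
    if xy: "x \<in> ginv_domain A" "y \<in> ginv_domain A" for x y
  proof -
    have "(x + y) - A (ginv A x + ginv A y) = (x - A (ginv A x)) + (y - A (ginv A y))"
      by (simp add: add)
    also have "\<dots> \<in> kernel A" by (intro K(2) ginv_domainE xy)
    finally show ?thesis using ginv_eqI[OF P(2)] ginv_domainE(1) xy by blast
  qed
  moreover have "a *\<^sub>C x \<in> ginv_domain A \<and> ginv A (a *\<^sub>C x) = a *\<^sub>C ginv A x"
    if x: "x \<in> ginv_domain A" for a x
  proof -
    have "a *\<^sub>C x - A (a *\<^sub>C ginv A x) = a *\<^sub>C (x - A (ginv A x))"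
      by (metis add_diff_cancel_right' diff_add_cancel scaleC scaleC_add_right)
    also have "\<dots> \<in> kernel A" by (intro K(3) ginv_domainE x)
    finally show ?thesis using ginv_eqI[OF P(3)] ginv_domainE(1) x by blast
  qed
  moreover have "0 \<in> ginv_domain A"
    using ginv_eqI(1)[OF P(1), of 0] K(1) by (simp add: zero)
  ultimately show ?thesis unfolding linear_operator_def csubspace_def by blast
qed

lemma closed_ginv: "closed_operator (ginv_domain A) (ginv A)"
proof -
  have "{(u, g). g \<in> ortho_complement (kernel A) \<and> u - A g \<in> kernel A} =
      snd -` ortho_complement (kernel A) \<inter> (\<lambda>p. fst p - A (snd p)) -` kernel A" by auto
  moreover have "closed \<dots>"
    by (intro closed_Int closed_vimage closed_ortho_complement closed_kernel continuous_intros
        bounded_linear.continuous_on[OF bounded_linear])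
  ultimately show ?thesis unfolding closed_operator_def ginv_graph by simp
qed

text \<open>An eigenvector is the image of its multiple by the inverse eigenvalue, so the closure of
  the domain contains the closed span of the eigenbasis. It also contains the kernel and is a
  subspace, hence contains every sum of the two.\<close>

lemma dense_ginv: "densely_defined (ginv_domain A)"
proof -
  have sub: "csubspace (closure (ginv_domain A))"
    using linear_ginv by (intro csubspace_closure) (simp add: linear_operator_def)
  obtain X l where "eigenbasis A X l" using exists_eigenbasis by blast
  then have cl: "closure (cspan X) = ortho_complement (kernel A)"
    and l: "\<And>x. x \<in> X \<Longrightarrow> 0 < l x" "\<And>x. x \<in> X \<Longrightarrow> A x = l x *\<^sub>R x"
    by (auto simp: eigenbasis_def is_onb_of_def)
  have K: "kernel A \<subseteq> ginv_domain A"
    by (rule subsetI, rule ginv_eqI(1)[OF csubspaceD(1)[OF csubspace_ortho_complement]])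
      (simp add: zero)
  have "X \<subseteq> closure (ginv_domain A)"
  proof
    fix x assume x: "x \<in> X"
    have "x = A (inverse (l x) *\<^sub>R x)" using l[OF x] by (simp add: scaleR)
    then have "x \<in> ginv_domain A"
      by (intro ginv_domainI[OF csubspaceD(1)[OF csubspace_kernel]]) simp
    then show "x \<in> closure (ginv_domain A)" using closure_subset by blast
  qed
  then have P: "ortho_complement (kernel A) \<subseteq> closure (ginv_domain A)"
    unfolding cl[symmetric] by (intro closure_minimal cspan_minimal sub) auto
  have "u \<in> closure (ginv_domain A)" for u
  proof -
    obtain p q where "u = p + q" "p \<in> kernel A" "q \<in> ortho_complement (kernel A)"
      by (rule orthogonal_decomposition[OF csubspace_kernel closed_kernel])
    moreover from this have "p \<in> closure (ginv_domain A)" "q \<in> closure (ginv_domain A)"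
      using K P closure_subset by blast+
    ultimately show ?thesis using csubspaceD(2)[OF sub] by simp
  qed
  then show ?thesis by (auto simp: densely_defined_def)
qed

lemma unbounded_ginv:
  assumes "\<not> closed (range A)"
  shows "\<not> bounded_operator (ginv_domain A) (ginv A)"
proof
  assume "bounded_operator (ginv_domain A) (ginv A)"
  then obtain C' where C': "\<And>u. u \<in> ginv_domain A \<Longrightarrow> norm (ginv A u) \<le> C' * norm u"
    by (auto simp: bounded_operator_def)
  \<comment> \<open>The maximum makes the constant positive, as the division \<open>e / K\<close>
    below demands.\<close>
  define K where "K = max C' 1"
  have K: "norm (ginv A u) \<le> K * norm u" if "u \<in> ginv_domain A" for u
    using C'[OF that] by (rule order_trans) (simp add: K_def mult_right_mono)
  have K0: "0 < K" by (simp add: K_def)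
  have "closed (range A)"
    unfolding closed_sequential_limits
  proof safe
    fix y v assume y: "\<forall>n::nat. y n \<in> range A" and lim: "y \<longlonglongrightarrow> v"
    have yD: "y n \<in> ginv_domain A" for n
    proof -
      obtain z where "y n = A z" using y by blast
      then show ?thesis by (intro ginv_domainI[OF csubspaceD(1)[OF csubspace_kernel], of _ z]) simp
    qed
    \<comment> \<open>The difference lies both in the range and in the kernel, which are
      orthogonal.\<close>
    have Ay: "A (ginv A (y n)) = y n" for n
    proof -
      have "y n - A (ginv A (y n)) = A (z - ginv A (y n))" if "y n = A z" for z
        using that by (simp add: diff)
      then obtain z where z: "y n - A (ginv A (y n)) = A z" using y by blast
      have "cinner (A z) (A z) = 0"
        using ginv_domainE(2)[OF yD, of n] range_orthogonal_kernel z by simp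
      then show ?thesis using z by (simp add: cinner_eq_zero_iff)
    qed
    have diffD: "y i - y j \<in> ginv_domain A \<and> ginv A (y i - y j) = ginv A (y i) - ginv A (y j)" for i j
    proof -
      have "ginv A (y i) - ginv A (y j) \<in> ortho_complement (kernel A)"
        by (intro csubspaceD(6)[OF csubspace_ortho_complement] ginv_domainE yD)
      moreover have "(y i - y j) - A (ginv A (y i) - ginv A (y j)) \<in> kernel A"
        by (simp add: diff Ay kernel_def zero)
      ultimately show ?thesis using ginv_eqI by blast
    qed
    have "Cauchy (\<lambda>n. ginv A (y n))"
    proof (rule metric_CauchyI)
      fix e :: real assume "0 < e"
      then have "0 < e / K" using K0 by simp
      from metric_CauchyD[OF LIMSEQ_imp_Cauchy[OF lim] this] obtain N
        where N: "\<And>i j. i \<ge> N \<Longrightarrow> j \<ge> N \<Longrightarrow> dist (y i) (y j) < e / K" by blast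
      have "dist (ginv A (y i)) (ginv A (y j)) < e" if "i \<ge> N" "j \<ge> N" for i j
      proof -
        have "dist (ginv A (y i)) (ginv A (y j)) \<le> K * dist (y i) (y j)"
          using K[of "y i - y j"] diffD[of i j] by (simp add: dist_norm)
        also have "\<dots> < e" using N[OF that] K0 by (simp add: field_simps)
        finally show ?thesis .
      qed
      then show "\<exists>N. \<forall>i\<ge>N. \<forall>j\<ge>N. dist (ginv A (y i)) (ginv A (y j)) < e" by blast
    qed
    then obtain g where "(\<lambda>n. ginv A (y n)) \<longlonglongrightarrow> g"
      by (auto simp: Cauchy_convergent_iff convergent_def)
    from bounded_linear.tendsto[OF bounded_linear this] have "y \<longlonglongrightarrow> A g" by (simp add: Ay)
    then show "v \<in> range A" using lim LIMSEQ_unique by blast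
  qed
  then show False using assms by simp
qed

text \<open>Values of \<open>ginv A\<close> are orthogonal to the kernel, so \<open>y\<close> and
  \<open>x\<close> may be replaced by \<open>A (ginv A y)\<close> and \<open>A (ginv A x)\<close>;
  symmetry of \<open>A\<close> does the rest.\<close>

lemma ginv_symmetric:
  assumes x: "x \<in> ginv_domain A" and y: "y \<in> ginv_domain A"
  shows "cinner (ginv A x) y = cinner x (ginv A y)"
proof -
  have "cinner (ginv A x) (y - A (ginv A y)) = 0"
    using ginv_domainE(1)[OF x] ginv_domainE(2)[OF y] by (simp add: ortho_complement_def)
  moreover have "cinner (x - A (ginv A x)) (ginv A y) = 0"
    using ortho_complement_swap[OF ginv_domainE(1)[OF y] ginv_domainE(2)[OF x]] .
  ultimately show ?thesis by (simp add: cinner_simps symmetric)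
qed

text \<open>Testing with kernel vectors, where \<open>ginv A\<close> vanishes, puts \<open>z\<close>
  in the complement of the kernel. Testing with \<open>A a\<close> for \<open>a\<close> in that
  complement puts \<open>y - A z\<close> in the double complement, which is the kernel. Hence the
  adjoint does not extend \<open>ginv A\<close> properly.\<close>

lemma ginv_adjointI:
  assumes z: "\<And>x. x \<in> ginv_domain A \<Longrightarrow> cinner (ginv A x) y = cinner x z"
  shows "y \<in> ginv_domain A" "ginv A y = z"
proof -
  have z_orth: "z \<in> ortho_complement (kernel A)"
    unfolding ortho_complement_def
  proof safe
    fix n assume "n \<in> kernel A"
    then have "n \<in> ginv_domain A \<and> ginv A n = 0"
      using ginv_eqI[of 0 n] csubspaceD(1)[OF csubspace_ortho_complement[of "kernel A"]]
      by (simp add: zero)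
    then have "cinner n z = 0" using z[of n] by simp
    then show "cinner z n = 0" using cinner_commute[of z n] by simp
  qed
  have "y - A z \<in> ortho_complement (ortho_complement (kernel A))"
    unfolding ortho_complement_def[of "ortho_complement (kernel A)"]
  proof safe
    fix a assume a: "a \<in> ortho_complement (kernel A)"
    have "A a \<in> ginv_domain A \<and> ginv A (A a) = a"
      using ginv_eqI[OF a, of "A a"] csubspaceD(1)[OF csubspace_kernel] by simp
    then have "cinner a (y - A z) = 0" using z[of "A a"] by (simp add: cinner_simps symmetric)
    then show "cinner (y - A z) a = 0" using cinner_commute[of "y - A z" a] by simp
  qed
  then have "y - A z \<in> kernel A"
    by (simp add: double_ortho_complement csubspace_kernel closed_kernel)
  with z_orth show "y \<in> ginv_domain A" "ginv A y = z" using ginv_eqI by auto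
qed

lemma self_adjoint_ginv: "self_adjoint_operator (ginv_domain A) (ginv A)"
  unfolding self_adjoint_operator_def
proof (intro conjI ballI dense_ginv)
  show "adjoint_domain (ginv_domain A) (ginv A) = ginv_domain A"
    using ginv_adjointI(1) ginv_symmetric unfolding adjoint_domain_def by blast
  fix y assume y: "y \<in> ginv_domain A"
  show "adjoint_operator (ginv_domain A) (ginv A) y = ginv A y"
    unfolding adjoint_operator_def
  proof (rule the_equality)
    show "\<forall>x\<in>ginv_domain A. cinner (ginv A x) y = cinner x (ginv A y)"
      using ginv_symmetric y by blast
    show "z = ginv A y" if "\<forall>x\<in>ginv_domain A. cinner (ginv A x) y = cinner x z" for z
      using ginv_adjointI(2)[of y z] that by blast
  qed
qed

end


section \<open>The strong integral\<close>

text \<open>Off a null set the limit is pointwise, and pointwise limits of Borel functions into a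
  metric space are Borel even without separability. Completeness then absorbs the change of
  preimages on the null set.\<close>

lemma (in complete_measure) borel_measurable_AE_limit:
  fixes h :: "'a \<Rightarrow> 'b::metric_space"
  assumes h: "\<And>i. h' i \<in> borel_measurable M" and lim: "AE w in M. (\<lambda>i. h' i w) \<longlonglongrightarrow> h w"
  shows "h \<in> borel_measurable M"
proof -
  obtain N where N: "N \<in> null_sets M" "{w\<in>space M. \<not> (\<lambda>i. h' i w) \<longlonglongrightarrow> h w} \<subseteq> N"
    using lim by (auto elim!: AE_E simp: null_sets_def)
  have [measurable]: "N \<in> sets M" using N by auto
  \<comment> \<open>A common constant on \<open>N\<close> makes the sequence converge at every point
    of the space.\<close>
  let ?h = "\<lambda>w. if w \<in> N then undefined else h w"
  have "?h \<in> borel_measurable M"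
  proof (rule borel_measurable_LIMSEQ_metric)
    show "(\<lambda>w. if w \<in> N then undefined else h' i w) \<in> borel_measurable M" for i
      using h by measurable
    show "(\<lambda>i. if w \<in> N then undefined else h' i w) \<longlonglongrightarrow> ?h w" if "w \<in> space M" for w
      using that N by auto
  qed
  then have meas: "?h -` S \<inter> space M \<in> sets M" if "open S" for S
    using that by (simp add: measurable_sets)
  have ae: "AE w in M. w \<notin> N" using N by (rule_tac AE_not_in) auto
  show ?thesis
  proof (rule borel_measurableI)
    fix S :: "'b set" assume S: "open S"
    show "h -` S \<inter> space M \<in> sets M"
    proof (rule in_sets_AE[OF _ meas[OF S]])
      show "AE w in M. (w \<in> ?h -` S \<inter> space M) = (w \<in> h -` S \<inter> space M)"
        using ae by eventually_elim simp
    qed simp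
  qed
qed

lemma (in complete_measure) strongly_measurable_borel:
  "strongly_measurable M f \<Longrightarrow> f \<in> borel_measurable M"
  unfolding strongly_measurable_def
  by (elim exE conjE)
    (rule borel_measurable_AE_limit, rule borel_measurable_simple_function, erule spec)

lemma strongly_measurable_compose:
  assumes "strongly_measurable M f" "\<And>y. isCont T y"
  shows "strongly_measurable M (\<lambda>w. T (f w))"
proof -
  obtain s where s: "\<And>i. simple_function M (s i)" "AE w in M. (\<lambda>i. s i w) \<longlonglongrightarrow> f w"
    using assms(1) by (auto simp: strongly_measurable_def)
  have "AE w in M. (\<lambda>i. T (s i w)) \<longlonglongrightarrow> T (f w)"
    using s(2) by eventually_elim (rule isCont_tendsto_compose[OF assms(2)])
  then show ?thesis
    unfolding strongly_measurable_def
    by (intro exI[of _ "\<lambda>i w. T (s i w)"]) (simp add: s(1) simple_function_compose1[OF s(1)])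
qed

text \<open>In a nonseparable space a difference of Borel functions may fail to be Borel, so
  measurability of \<open>f - s\<close> is obtained through simple approximants.\<close>

lemma strongly_measurable_minus_simple:
  assumes "strongly_measurable M f" "simple_function M s"
  shows "strongly_measurable M (\<lambda>w. f w - s w)"
proof -
  obtain t where t: "\<And>i. simple_function M (t i)" "AE w in M. (\<lambda>i. t i w) \<longlonglongrightarrow> f w"
    using assms(1) by (auto simp: strongly_measurable_def)
  have "AE w in M. (\<lambda>i. t i w - s w) \<longlonglongrightarrow> f w - s w"
    using t(2) by eventually_elim (intro tendsto_intros)
  then show ?thesis
    unfolding strongly_measurable_def
    by (intro exI[of _ "\<lambda>i w. t i w - s w"]) (simp add: simple_function_compose2[OF t(1) assms(2)])
qed

text \<open>Triangle inequality through \<open>f\<close>, integrated. It makes the integrals of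
  simple functions converging to \<open>f\<close> in mean a Cauchy sequence.\<close>

lemma (in complete_measure) simple_bochner_integral_dist:
  fixes f :: "'a \<Rightarrow> 'b::real_normed_vector"
  assumes f: "strongly_measurable M f"
    and s: "Bochner_Integration.simple_bochner_integrable M s"
    and t: "Bochner_Integration.simple_bochner_integrable M t"
  shows "ennreal (norm (Bochner_Integration.simple_bochner_integral M s -
      Bochner_Integration.simple_bochner_integral M t)) \<le>
    (\<integral>\<^sup>+w. norm (f w - s w) \<partial>M) + (\<integral>\<^sup>+w. norm (f w - t w) \<partial>M)"
proof -
  let ?I = "Bochner_Integration.simple_bochner_integral M"
  have st: "Bochner_Integration.simple_bochner_integrable M (\<lambda>w. s w - t w)"
    "Bochner_Integration.simple_bochner_integrable M (\<lambda>w. norm (s w - t w))"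
    using simple_bochner_integrable_compose2[OF _ s t, of "(-)"]
      simple_bochner_integrable_compose2[OF _ s t, of "\<lambda>x y. norm (x - y)"] by auto
  have sf: "simple_function M s" "simple_function M t"
    using s t by (auto elim: simple_bochner_integrable.cases)
  have "ennreal (norm (?I s - ?I t)) \<le> ennreal (?I (\<lambda>w. norm (s w - t w)))"
    using simple_bochner_integral_norm_bound[OF st(1)]
    by (simp add: simple_bochner_integral_diff[OF s t] ennreal_leI)
  also have "\<dots> = (\<integral>\<^sup>+w. norm (s w - t w) \<partial>M)"
    by (rule simple_bochner_integral_eq_nn_integral[OF st(2)]) simp
  also have "\<dots> \<le> (\<integral>\<^sup>+w. ennreal (norm (f w - s w)) + ennreal (norm (f w - t w)) \<partial>M)"
  proof (rule nn_integral_mono)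
    fix w
    have "norm (s w - t w) \<le> norm (f w - s w) + norm (f w - t w)"
      using norm_triangle_ineq4[of "f w - t w" "f w - s w"] by simp
    then show "ennreal (norm (s w - t w)) \<le> ennreal (norm (f w - s w)) + ennreal (norm (f w - t w))"
      by (simp flip: ennreal_plus)
  qed
  also have "\<dots> = (\<integral>\<^sup>+w. norm (f w - s w) \<partial>M) + (\<integral>\<^sup>+w. norm (f w - t w) \<partial>M)"
    using strongly_measurable_borel[OF strongly_measurable_minus_simple[OF f sf(1)]]
      strongly_measurable_borel[OF strongly_measurable_minus_simple[OF f sf(2)]]
    by (intro nn_integral_add) auto
  finally show ?thesis .
qed

text \<open>Truncated simple approximants differ from \<open>g\<close> by at most
  \<open>3 * norm (g w)\<close>, so dominated convergence gives convergence in mean; their integrals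
  are Cauchy and converge by completeness of the target.\<close>

lemma has_strong_integral_exists:
  fixes g :: "'w \<Rightarrow> 'b::{real_normed_vector, complete_space}"
  assumes fin: "finite_measure M" and compl: "complete_measure M"
    and g: "strongly_measurable M g" and int: "integrable M (\<lambda>w. norm (g w))"
  shows "\<exists>I. has_strong_integral M g I"
proof -
  interpret finite_measure M by fact
  interpret complete_measure M by fact
  obtain s where s: "\<And>i. simple_function M (s i)" and lim: "AE w in M. (\<lambda>i. s i w) \<longlonglongrightarrow> g w"
    using g by (auto simp: strongly_measurable_def)
  have [measurable]: "g \<in> borel_measurable M" by (rule strongly_measurable_borel[OF g])
  have [measurable]: "s i \<in> borel_measurable M" for i
    by (rule borel_measurable_simple_function[OF s])
  \<comment> \<open>The truncation provides an integrable majorant.\<close>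
  define t where "t i w = (if norm (s i w) \<le> 2 * norm (g w) then s i w else 0)" for i w
  have sf: "simple_function M (t i)" for i
    unfolding t_def by (intro simple_function_If s simple_function_const) measurable
  have sbi: "Bochner_Integration.simple_bochner_integrable M (t i)" for i
    using sf by (rule simple_bochner_integrable.intros) simp
  have [measurable]: "(\<lambda>w. g w - t i w) \<in> borel_measurable M" for i
    by (intro strongly_measurable_borel strongly_measurable_minus_simple g sf)
  have "(\<lambda>i. \<integral>\<^sup>+w. norm (g w - t i w) \<partial>M) \<longlonglongrightarrow> (\<integral>\<^sup>+w. 0 \<partial>M)"
  proof (rule nn_integral_dominated_convergence[where w = "\<lambda>w. ennreal (3 * norm (g w))"])
    show "AE w in M. ennreal (norm (g w - t i w)) \<le> ennreal (3 * norm (g w))" for i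
    proof (rule AE_I2, rule ennreal_leI)
      fix w show "norm (g w - t i w) \<le> 3 * norm (g w)"
        using norm_triangle_ineq4[of "g w" "t i w"] by (auto simp: t_def split: if_splits)
    qed
    show "(\<integral>\<^sup>+w. ennreal (3 * norm (g w)) \<partial>M) < \<infinity>"
      using integrableD(2)[OF integrable_mult_right[OF int, of 3]] by (simp add: less_top)
    show "AE w in M. (\<lambda>i. ennreal (norm (g w - t i w))) \<longlonglongrightarrow> 0"
      using lim
    proof eventually_elim
      fix w assume l: "(\<lambda>i. s i w) \<longlonglongrightarrow> g w"
      \<comment> \<open>Where \<open>g w\<close> is zero the truncation forces
        \<open>t i w = 0\<close>; elsewhere the factor 2 leaves room for the truncation to be
        eventually inactive.\<close>
      have "(\<lambda>i. t i w) \<longlonglongrightarrow> g w"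
      proof (cases "g w = 0")
        case True
        then have "t i w = 0" for i by (simp add: t_def)
        then show ?thesis using True by simp
      next
        case False
        then have "\<forall>\<^sub>F i in sequentially. norm (s i w) < 2 * norm (g w)"
          by (intro order_tendstoD(2)[OF tendsto_norm[OF l]]) simp
        then have "\<forall>\<^sub>F i in sequentially. s i w = t i w"
          by eventually_elim (simp add: t_def)
        then show ?thesis using l by (rule Lim_transform_eventually[rotated])
      qed
      then have "(\<lambda>i. norm (g w - t i w)) \<longlonglongrightarrow> norm (g w - g w)" by (intro tendsto_intros)
      then show "(\<lambda>i. ennreal (norm (g w - t i w))) \<longlonglongrightarrow> 0"
        using tendsto_ennrealI by fastforce
    qed
  qed measurable
  then have conv: "(\<lambda>i. \<integral>\<^sup>+w. norm (g w - t i w) \<partial>M) \<longlonglongrightarrow> 0" by simp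
  let ?y = "\<lambda>i. Bochner_Integration.simple_bochner_integral M (t i)"
  have "Cauchy ?y"
  proof (rule metric_CauchyI)
    fix e :: real assume e: "0 < e"
    then have "\<forall>\<^sub>F i in sequentially. (\<integral>\<^sup>+w. norm (g w - t i w) \<partial>M) < ennreal (e / 2)"
      by (intro order_tendstoD(2)[OF conv]) simp
    then obtain N where N: "\<And>i. i \<ge> N \<Longrightarrow> (\<integral>\<^sup>+w. norm (g w - t i w) \<partial>M) < ennreal (e / 2)"
      by (auto simp: eventually_sequentially)
    have "dist (?y i) (?y j) < e" if "i \<ge> N" "j \<ge> N" for i j
    proof -
      have "ennreal (norm (?y i - ?y j)) < ennreal (e / 2) + ennreal (e / 2)"
        using simple_bochner_integral_dist[OF g sbi sbi, of i j] N[OF that(1)] N[OF that(2)]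
        by (meson add_strict_mono le_less_trans)
      also have "\<dots> = ennreal e" using e by (simp flip: ennreal_plus)
      finally show ?thesis using e by (simp add: dist_norm ennreal_less_iff)
    qed
    then show "\<exists>N. \<forall>i\<ge>N. \<forall>j\<ge>N. dist (?y i) (?y j) < e" by blast
  qed
  then obtain I where "?y \<longlonglongrightarrow> I" by (auto simp: Cauchy_convergent_iff convergent_def)
  then show ?thesis unfolding has_strong_integral_def using g sbi conv by blast
qed

text \<open>Applying \<open>T\<close> to the approximants multiplies the mean error by at most a
  bound of \<open>T\<close>. Identities between vector-valued integrals thus reduce to scalar
  integrals.\<close>

lemma has_bochner_integral_bounded_linear_strong:
  fixes T :: "'b::real_normed_vector \<Rightarrow> 'c::{real_normed_vector, second_countable_topology}"
  assumes compl: "complete_measure M" and I: "has_strong_integral M g I" and T: "bounded_linear T"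
  shows "has_bochner_integral M (\<lambda>w. T (g w)) (T I)"
proof -
  interpret complete_measure M by fact
  interpret T: bounded_linear T by fact
  have g: "strongly_measurable M g" using I by (simp add: has_strong_integral_def)
  obtain s where s: "\<And>i. Bochner_Integration.simple_bochner_integrable M (s i)"
    and conv: "(\<lambda>i. \<integral>\<^sup>+w. norm (g w - s i w) \<partial>M) \<longlonglongrightarrow> 0"
    and lim: "(\<lambda>i. Bochner_Integration.simple_bochner_integral M (s i)) \<longlonglongrightarrow> I"
    using I by (auto simp: has_strong_integral_def)
  have sf: "simple_function M (s i)" for i
    using s by (auto elim: simple_bochner_integrable.cases)
  obtain K where K: "\<And>x. norm (T x) \<le> norm x * K" "0 \<le> K" using T.nonneg_bounded by blast
  show ?thesis
  proof (rule has_bochner_integral.intros)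
    show "(\<lambda>w. T (g w)) \<in> borel_measurable M"
      by (intro strongly_measurable_borel strongly_measurable_compose[OF g] linear_continuous_at T)
    show "Bochner_Integration.simple_bochner_integrable M (\<lambda>w. T (s i w))" for i
      using simple_bochner_integrable_compose2[OF _ s s, of "\<lambda>x y. T x" i i] by (simp add: T.zero)
    show "(\<lambda>i. \<integral>\<^sup>+w. norm (T (g w) - T (s i w)) \<partial>M) \<longlonglongrightarrow> 0"
    proof (rule tendsto_sandwich[of "\<lambda>_. 0" _ _ "\<lambda>i. ennreal K * (\<integral>\<^sup>+w. norm (g w - s i w) \<partial>M)"])
      have "(\<integral>\<^sup>+w. norm (T (g w) - T (s i w)) \<partial>M) \<le> ennreal K * (\<integral>\<^sup>+w. norm (g w - s i w) \<partial>M)" for i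
      proof -
        have [measurable]: "(\<lambda>w. g w - s i w) \<in> borel_measurable M"
          by (intro strongly_measurable_borel strongly_measurable_minus_simple g sf)
        have "(\<integral>\<^sup>+w. norm (T (g w) - T (s i w)) \<partial>M) \<le>
            (\<integral>\<^sup>+w. ennreal K * ennreal (norm (g w - s i w)) \<partial>M)"
          using K(1)[of "g _ - s i _"] K(2)
          by (intro nn_integral_mono) (simp add: T.diff mult.commute flip: ennreal_mult)
        also have "\<dots> = ennreal K * (\<integral>\<^sup>+w. norm (g w - s i w) \<partial>M)"
          by (rule nn_integral_cmult) measurable
        finally show ?thesis .
      qed
      then show "\<forall>\<^sub>F i in sequentially. (\<integral>\<^sup>+w. norm (T (g w) - T (s i w)) \<partial>M)
          \<le> ennreal K * (\<integral>\<^sup>+w. norm (g w - s i w) \<partial>M)" by simp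
      show "(\<lambda>i. ennreal K * (\<integral>\<^sup>+w. norm (g w - s i w) \<partial>M)) \<longlonglongrightarrow> 0"
        using ennreal_tendsto_cmult[OF _ conv, of "ennreal K"] by simp
    qed auto
    show "(\<lambda>i. Bochner_Integration.simple_bochner_integral M (\<lambda>w. T (s i w))) \<longlonglongrightarrow> T I"
      using T.tendsto[OF lim] by (simp add: simple_bochner_integral_linear[OF T.linear s])
  qed
qed


section \<open>The auto-covariance operator\<close>

text \<open>The integrand of \<open>autocov\<close> has norm at most
  \<open>norm x * (norm (f w))\<^sup>2\<close>, so its strong integral exists. Pairing with
  \<open>y\<close> commutes with integration; the pairings also show that the integral is unique, so
  \<open>autocov\<close> denotes it.\<close>

lemma has_bochner_integral_autocov:
  fixes f :: "'w \<Rightarrow> 'h::chilbert_space"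
  assumes fin: "finite_measure M" and compl: "complete_measure M" and f: "f \<in> L2_functions M"
  shows "has_bochner_integral M (\<lambda>w. cinner x (f w) * cinner (f w) y) (cinner (autocov M f x) y)"
proof -
  interpret complete_measure M by fact
  let ?g = "\<lambda>w. cinner x (f w) *\<^sub>C f w"
  have sm: "strongly_measurable M f" and L2: "integrable M (\<lambda>w. (norm (f w))\<^sup>2)"
    using f by (auto simp: L2_functions_def)
  have smg: "strongly_measurable M ?g"
  proof (rule strongly_measurable_compose[OF sm])
    show "isCont (\<lambda>y. cinner x y *\<^sub>C y) y" for y
      unfolding isCont_def by (intro tendsto_intros)
  qed
  have "integrable M (\<lambda>w. norm (?g w))"
  proof (rule Bochner_Integration.integrable_bound)
    show "integrable M (\<lambda>w. norm x * (norm (f w))\<^sup>2)" using L2 by simp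
    show "(\<lambda>w. norm (?g w)) \<in> borel_measurable M"
      using strongly_measurable_borel[OF smg] by measurable
    show "AE w in M. norm (norm (?g w)) \<le> norm (norm x * (norm (f w))\<^sup>2)"
      using mult_right_mono[OF cauchy_schwarz, of "norm (f _)" x]
      by (intro AE_I2) (simp add: norm_scaleC power2_eq_square mult.assoc)
  qed
  then obtain I where I: "has_strong_integral M ?g I"
    using has_strong_integral_exists[OF fin compl smg] by blast
  have bl: "bounded_linear (\<lambda>v. cinner v z)" for z :: 'h
    by (rule bounded_bilinear.bounded_linear_left[OF bounded_bilinear_cinner])
  have weak: "has_bochner_integral M (\<lambda>w. cinner x (f w) * cinner (f w) z) (cinner J z)"
    if "has_strong_integral M ?g J" for J z
    using has_bochner_integral_bounded_linear_strong[OF compl that bl, of z]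
    by (simp add: cinner_scaleC_left)
  have "J = I" if "has_strong_integral M ?g J" for J
    by (rule cinner_ext) (rule has_bochner_integral_eq[OF weak[OF that] weak[OF I]])
  then have "(THE J. has_strong_integral M ?g J) = I" using I by blast
  then have "autocov M f x = I" using I by (auto simp: autocov_def strong_integral_def)
  then show ?thesis using weak[OF I] by simp
qed

text \<open>Algebraic identities are read off the weak formula, since vectors are determined by
  their pairings. The quadratic form is the integral of
  \<open>(cmod (cinner (f w) x))\<^sup>2\<close>; Bessel's inequality at each point, integrated,
  bounds the trace.\<close>

lemma positive_trace_class_autocov:
  fixes f :: "'w \<Rightarrow> 'h::chilbert_space"
  assumes fin: "finite_measure M" and compl: "complete_measure M" and f: "f \<in> L2_functions M"
  shows "positive_trace_class (autocov M f) (\<integral>w. (norm (f w))\<^sup>2 \<partial>M)"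
proof
  note weak = has_bochner_integral_autocov[OF fin compl f]
  note eq = has_bochner_integral_eq[OF weak]
  have form: "has_bochner_integral M (\<lambda>w. (cmod (cinner (f w) x))\<^sup>2) (Re (cinner (autocov M f x) x))"
    for x
  proof -
    have "Re (cinner x (f w) * cinner (f w) x) = (cmod (cinner (f w) x))\<^sup>2" for w
      by (subst cinner_commute[of x]) (simp add: mult.commute flip: complex_norm_square)
    then show ?thesis
      using has_bochner_integral_bounded_linear[OF bounded_linear_Re weak[of x x]] by simp
  qed
  show "autocov M f (x + y) = autocov M f x + autocov M f y" for x y
  proof (rule cinner_ext, rule eq)
    show "has_bochner_integral M (\<lambda>w. cinner (x + y) (f w) * cinner (f w) z)
        (cinner (autocov M f x + autocov M f y) z)" for z
      using has_bochner_integral_add[OF weak[of x z] weak[of y z]]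
      by (simp add: cinner_add_left distrib_right)
  qed
  show "autocov M f (a *\<^sub>C x) = a *\<^sub>C autocov M f x" for a x
  proof (rule cinner_ext, rule eq)
    show "has_bochner_integral M (\<lambda>w. cinner (a *\<^sub>C x) (f w) * cinner (f w) z)
        (cinner (a *\<^sub>C autocov M f x) z)" for z
      using has_bochner_integral_mult_right[OF weak[of x z], of a]
      by (simp add: cinner_scaleC_left mult.assoc)
  qed
  show "cinner (autocov M f x) y = cinner x (autocov M f y)" for x y
  proof (rule eq)
    have "cnj (cinner y (f w) * cinner (f w) x) = cinner x (f w) * cinner (f w) y" for w
      by (simp add: mult.commute flip: cinner_commute)
    then show "has_bochner_integral M (\<lambda>w. cinner x (f w) * cinner (f w) y) (cinner x (autocov M f y))"
      using has_bochner_integral_bounded_linear[OF bounded_linear_cnj weak[of y x]]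
      by (simp add: mult.commute flip: cinner_commute)
  qed
  show "0 \<le> Re (cinner (autocov M f x) x)" for x
    unfolding has_bochner_integral_integral_eq[OF form, symmetric] by simp
  show "(\<Sum>e\<in>F. Re (cinner (autocov M f e) e)) \<le> (\<integral>w. (norm (f w))\<^sup>2 \<partial>M)"
    if F: "finite F" "orthonormal F" for F
  proof -
    have "has_bochner_integral M (\<lambda>w. \<Sum>e\<in>F. (cmod (cinner (f w) e))\<^sup>2)
        (\<Sum>e\<in>F. Re (cinner (autocov M f e) e))"
      by (intro has_bochner_integral_sum form)
    then have "(\<Sum>e\<in>F. Re (cinner (autocov M f e) e)) =
        (\<integral>w. (\<Sum>e\<in>F. (cmod (cinner (f w) e))\<^sup>2) \<partial>M)"
      and int: "integrable M (\<lambda>w. \<Sum>e\<in>F. (cmod (cinner (f w) e))\<^sup>2)"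
      by (auto simp: has_bochner_integral_iff)
    then show ?thesis
      using f bessel[OF F(2,1)] by (auto simp: L2_functions_def intro!: integral_mono)
  qed
qed

theorem mainTheorem2:
  fixes M :: "'w measure" and f :: "'w \<Rightarrow> 'h::chilbert_space"
  assumes "prob_space M"
    and "complete_measure M"
    and "f \<in> L2_functions M"
    and "zero_mean M f"
    and "\<not> closed (range (autocov M f))"
  shows "linear_operator (ginv_domain (autocov M f)) (ginv (autocov M f)) \<and>
    \<not> bounded_operator (ginv_domain (autocov M f)) (ginv (autocov M f)) \<and>
    closed_operator (ginv_domain (autocov M f)) (ginv (autocov M f)) \<and>
    densely_defined (ginv_domain (autocov M f)) \<and>
    self_adjoint_operator (ginv_domain (autocov M f)) (ginv (autocov M f))"
proof -
  interpret prob_space M by fact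
  interpret A: positive_trace_class "autocov M f" "\<integral>w. (norm (f w))\<^sup>2 \<partial>M"
    by (rule positive_trace_class_autocov[OF finite_measure_axioms assms(2,3)])
  show ?thesis
    using A.linear_ginv A.unbounded_ginv[OF assms(5)] A.closed_ginv A.dense_ginv A.self_adjoint_ginv
    by blast
qed

end
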